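(* Let $\Phi:\mathbb R^3\to[0,\infty)$ be an admissible integrand (as defined in the context, with $n=2$) which is even, i.e. $\Phi(-z)=\Phi(z)$ for all $z$. Let $\Sigma\subset\mathbb R^3$ be a connected smooth oriented (embedded) proper surface without boundary, with unit normal $\nu_\Sigma$, satisfying $$\operatorname{tr}\bigl(D_T^2\Phi(\nu_\Sigma)\,\mathrm{II}_\Sigma\bigr)=0\qquad\text{on }\Sigma .$$ If $\Sigma$ is contained in a closed halfspace of $\mathbb R^3$, then $\Sigma$ is an affine plane.
   Context: Admissible integrand (for $n\ge1$; here $n=2$): a convex function $\Phi:\mathbb R^{n+1}\to[0,\infty)$ with $\Phi(0)=0$ and $\Phi(tz)=t\Phi(z)$ for $t\ge0$, of class $C^3$ on $\mathbb R^{n+1}\setminus\{0\}$, such that for some $\lambda\in(0,1]$: $\lambda\le\Phi(\nu)\le\lambda^{-1}$ for $\nu\in\mathbb S^n$, $\|\Phi\|_{C^3(\mathbb S^n)}\le\lambda^{-1}$, and $\lambda|\tau|^2\le D^2\Phi(\nu)[\tau,\tau]\le\lambda^{-1}|\tau|^2$ for all $\nu\in\mathbb S^n$, $\tau\perp\nu$. $D_T^2\Phi(\nu)$ is the restriction of $D^2\Phi(\nu)$ to $\nu^\perp\times\nu^\perp$. The second fundamental form is $\mathrm{II}_\Sigma(X,Y)=-\langle\nabla_X\nu_\Sigma,Y\rangle$ for tangent vectors $X,Y$ ($\nabla$ the Euclidean connection), and for an orthonormal basis $\tau_1,\dots,\tau_n$ of $T_x\Sigma$, $$\operatorname{tr}\bigl(D_T^2\Phi(\nu_\Sigma(x))\,\mathrm{II}_\Sigma\bigr)=\sum_{i,j=1}^nD^2\Phi(\nu_\Sigma(x))[\tau_i,\tau_j]\,\mathrm{II}_\Sigma(\tau_i,\tau_j).$$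 A surface written as a subset of $\mathbb R^3$ is understood to be embedded. Proper means that $\Sigma\cap C$ is compact in $\Sigma$ for every compact $C\subset\mathbb R^3$. *)

theory Defs
  imports "HOL-Analysis.Analysis"
begin

text \<open>\<open>iter_deriv f [v1, ..., vk] x\<close> is \<open>D^k f(x)[v1, ..., vk]\<close>, the iterated Frechet derivative.
  It is only meaningful where the derivatives involved exist, which is what \<open>Ck_on\<close> guarantees.\<close>

fun iter_deriv ::
  "('a::real_normed_vector \<Rightarrow> 'b::real_normed_vector) \<Rightarrow> 'a list \<Rightarrow> 'a \<Rightarrow> 'b" where
  "iter_deriv f [] x = f x"
| "iter_deriv f (v # vs) x = frechet_derivative (iter_deriv f vs) (at x) v"

text \<open>Class \<open>C^k\<close> on a set \<open>U\<close>, which is meant to be open. In finite dimension, continuity of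
  \<open>x \<mapsto> D^j f(x)[v1, ..., vj]\<close> for all fixed directions is continuity of \<open>D^j f\<close>.\<close>

definition Ck_on ::
  "nat \<Rightarrow> ('a::euclidean_space \<Rightarrow> 'b::real_normed_vector) \<Rightarrow> 'a set \<Rightarrow> bool" where
  "Ck_on k f U \<longleftrightarrow>
     (\<forall>vs. length vs < k \<longrightarrow> iter_deriv f vs differentiable_on U) \<and>
     (\<forall>vs. length vs \<le> k \<longrightarrow> continuous_on U (iter_deriv f vs))"

definition smooth_on ::
  "('a::euclidean_space \<Rightarrow> 'b::real_normed_vector) \<Rightarrow> 'a set \<Rightarrow> bool" where
  "smooth_on f U \<longleftrightarrow> (\<forall>k. Ck_on k f U)"

text \<open>The operator norm of the \<open>k\<close>-linear form \<open>D^k f(x)\<close>.\<close>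

definition deriv_norm ::
  "nat \<Rightarrow> ('a::euclidean_space \<Rightarrow> 'b::real_normed_vector) \<Rightarrow> 'a \<Rightarrow> real" where
  "deriv_norm k f x =
     (SUP vs\<in>{vs. length vs = k \<and> (\<forall>v\<in>set vs. norm v = 1)}. norm (iter_deriv f vs x))"

text \<open>The \<open>C^k\<close> norm on the unit sphere, taken with the derivatives of \<open>f\<close> in the ambient space.
  For \<open>f\<close> of class \<open>C^k\<close> near the sphere the suprema are over bounded sets.\<close>

definition Ck_norm_sphere ::
  "nat \<Rightarrow> ('a::euclidean_space \<Rightarrow> 'b::real_normed_vector) \<Rightarrow> real" where
  "Ck_norm_sphere k f = (\<Sum>j\<le>k. SUP \<nu>\<in>sphere 0 1. deriv_norm j f \<nu>)"

definition admissible_integrand :: "('a::euclidean_space \<Rightarrow> real) \<Rightarrow> bool" where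
  "admissible_integrand \<Phi> \<longleftrightarrow>
     (\<forall>z. 0 \<le> \<Phi> z) \<and>
     convex_on UNIV \<Phi> \<and>
     \<Phi> 0 = 0 \<and>
     (\<forall>t\<ge>0. \<forall>z. \<Phi> (t *\<^sub>R z) = t * \<Phi> z) \<and>
     Ck_on 3 \<Phi> (- {0}) \<and>
     (\<exists>c::real. 0 < c \<and> c \<le> 1 \<and>
        (\<forall>\<nu>\<in>sphere 0 1. c \<le> \<Phi> \<nu> \<and> \<Phi> \<nu> \<le> inverse c) \<and>
        Ck_norm_sphere 3 \<Phi> \<le> inverse c \<and>
        (\<forall>\<nu>\<in>sphere 0 1. \<forall>\<tau>. \<tau> \<bullet> \<nu> = 0 \<longrightarrow>
           c * (norm \<tau>)\<^sup>2 \<le> iter_deriv \<Phi> [\<tau>, \<tau>] \<nu> \<and>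
           iter_deriv \<Phi> [\<tau>, \<tau>] \<nu> \<le> inverse c * (norm \<tau>)\<^sup>2))"

text \<open>Smooth embedded surfaces without boundary, by local parametrizations: each point has a
  neighbourhood in \<open>\<Sigma>\<close> (with the subspace topology) which is the homeomorphic image of an open
  subset of the plane under a smooth immersion.\<close>

definition smooth_surface :: "(real^3) set \<Rightarrow> bool" where
  "smooth_surface \<Sigma> \<longleftrightarrow>
     (\<forall>p\<in>\<Sigma>. \<exists>U V (\<phi> :: real^2 \<Rightarrow> real^3) \<psi>.
        open U \<and> p \<in> U \<and> open V \<and>
        homeomorphism V (\<Sigma> \<inter> U) \<phi> \<psi> \<and>
        smooth_on \<phi> V \<and>
        (\<forall>u\<in>V. inj (frechet_derivative \<phi> (at u))))"

text \<open>The tangent space, as the set of velocities of smooth curves in \<open>\<Sigma>\<close> through \<open>x\<close>.\<close>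

definition tangent_space :: "(real^3) set \<Rightarrow> real^3 \<Rightarrow> (real^3) set" where
  "tangent_space \<Sigma> x =
     {v. \<exists>\<gamma> e. 0 < e \<and> smooth_on \<gamma> {-e<..<e} \<and> \<gamma> ` {-e<..<e} \<subseteq> \<Sigma> \<and> \<gamma> 0 = x \<and>
           (\<gamma> has_vector_derivative v) (at 0)}"

text \<open>An orientation is given by a continuous unit normal field; on a smooth surface such a field
  is automatically smooth. Values of \<open>\<nu>\<close> off \<open>\<Sigma>\<close> are irrelevant.\<close>

definition unit_normal :: "(real^3) set \<Rightarrow> (real^3 \<Rightarrow> real^3) \<Rightarrow> bool" where
  "unit_normal \<Sigma> \<nu> \<longleftrightarrow>
     continuous_on \<Sigma> \<nu> \<and>
     (\<forall>x\<in>\<Sigma>. norm (\<nu> x) = 1 \<and> (\<forall>v\<in>tangent_space \<Sigma> x. \<nu> x \<bullet> v = 0))"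

text \<open>The derivative of \<open>\<nu>\<close> at \<open>x\<close> within \<open>\<Sigma>\<close> is determined only on tangent vectors, so
  \<open>second_fundamental_form \<Sigma> \<nu> x X Y\<close> is to be used for \<open>X\<close>, \<open>Y\<close> in \<open>tangent_space \<Sigma> x\<close> only.\<close>

definition second_fundamental_form ::
  "(real^3) set \<Rightarrow> (real^3 \<Rightarrow> real^3) \<Rightarrow> real^3 \<Rightarrow> real^3 \<Rightarrow> real^3 \<Rightarrow> real" where
  "second_fundamental_form \<Sigma> \<nu> x X Y = - (frechet_derivative \<nu> (at x within \<Sigma>) X \<bullet> Y)"

definition orthonormal_basis :: "('a::euclidean_space) set \<Rightarrow> 'a set \<Rightarrow> bool" where
  "orthonormal_basis B T \<longleftrightarrow>
     pairwise orthogonal B \<and> (\<forall>\<tau>\<in>B. norm \<tau> = 1) \<and> span B = T"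

text \<open>The trace of \<open>D_T^2 \<Phi>(\<nu>(x)) II\<close>. The sum does not depend on the orthonormal basis of the
  tangent space chosen.\<close>

definition aniso_trace ::
  "(real^3 \<Rightarrow> real) \<Rightarrow> (real^3) set \<Rightarrow> (real^3 \<Rightarrow> real^3) \<Rightarrow> real^3 \<Rightarrow> real" where
  "aniso_trace \<Phi> \<Sigma> \<nu> x =
     (let B = (SOME B. orthonormal_basis B (tangent_space \<Sigma> x)) in
      \<Sum>\<sigma>\<in>B. \<Sum>\<tau>\<in>B.
        iter_deriv \<Phi> [\<sigma>, \<tau>] (\<nu> x) * second_fundamental_form \<Sigma> \<nu> x \<sigma> \<tau>)"

definition proper_in_space :: "(real^3) set \<Rightarrow> bool" where
  "proper_in_space \<Sigma> \<longleftrightarrow> (\<forall>C. compact C \<longrightarrow> compact (\<Sigma> \<inter> C))"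

end

theory Submission
  imports Defs
begin

text \<open>The surface \<open>\<Sigma>\<close> is a solution in the touching sense: if \<open>F\<close> restricted to \<open>\<Sigma>\<close> has a local
  minimum at \<open>p\<close> and \<open>\<nabla>F(p) \<noteq> 0\<close>, then \<open>\<nabla>F(p)\<close> is normal to \<open>\<Sigma>\<close>, and comparing second
  derivatives along \<open>\<Sigma>\<close> gives \<open>tr (D\<^sup>2\<Phi>(\<nabla>F/|\<nabla>F|) D\<^sup>2F) \<ge> 0\<close> at \<open>p\<close>; evenness of \<open>\<Phi>\<close> makes
  the sign of the normal irrelevant.

  Let \<open>e\<close> be the inner unit normal of the halfspace and \<open>m\<close> the infimum of \<open>e \<bullet> x\<close> on \<open>\<Sigma>\<close>. If
  the plane \<open>e \<bullet> x = m\<close> were not contained in \<open>\<Sigma>\<close>, a small disc of it would be disjoint from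
  \<open>\<Sigma>\<close>, and \<open>\<Sigma>\<close> would stay at some height \<open>\<delta>\<close> above that disc. The function
  \<open>F = e \<bullet> x + \<epsilon> (ln r - r\<^bsup>-1/2\<^esup>)\<close>, where \<open>r\<close> is the Euclidean distance to the axis of the
  disc after a linear change of coordinates turning \<open>D\<^sup>2\<Phi>(e)\<close> into a multiple of the identity, has
  \<open>tr (D\<^sup>2\<Phi>(e) D\<^sup>2F)\<close> of order \<open>- \<epsilon> r\<^bsup>-5/2\<^esup>\<close>, while replacing \<open>e\<close> by \<open>\<nabla>F/|\<nabla>F|\<close> costs
  \<open>O(\<epsilon>\<^sup>2 r\<^bsup>-3\<^esup>)\<close>. So for small \<open>\<epsilon>\<close> the minimum of \<open>F\<close> over the part of \<open>\<Sigma>\<close> outside the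
  disc can only be on \<open>r = 1\<close>; letting \<open>\<epsilon> \<rightarrow> 0\<close> forces \<open>e \<bullet> x \<ge> m + \<delta>/2\<close> on \<open>\<Sigma>\<close>. This treats
  interior contact and contact at infinity at once, and no strong maximum principle is needed.

  Hence \<open>\<Sigma>\<close> contains the plane, which is open in \<open>\<Sigma>\<close> by invariance of domain and closed, and
  \<open>\<Sigma>\<close> is connected.\<close>

section \<open>Iterated derivatives\<close>

declare iter_deriv.simps [simp del]

lemma Ck_on_has_derivative:
  assumes "Ck_on k f U" "open U" "x \<in> U" "length vs < k"
  shows "(iter_deriv f vs has_derivative (\<lambda>v. iter_deriv f (v # vs) x)) (at x)"
proof -
  have "iter_deriv f vs differentiable (at x)"
    using assms unfolding Ck_on_def
    by (metis differentiable_on_eq_differentiable_at)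
  then show ?thesis
    by (simp add: frechet_derivative_works iter_deriv.simps)
qed

lemma smooth_on_has_derivative:
  assumes "smooth_on f U" "open U" "x \<in> U"
  shows "(iter_deriv f vs has_derivative (\<lambda>v. iter_deriv f (v # vs) x)) (at x)"
  using Ck_on_has_derivative[of "Suc (length vs)" f U x vs] assms by (simp add: smooth_on_def)

lemma smooth_onI:
  assumes "open U"
    and "\<And>vs x. x \<in> U \<Longrightarrow> iter_deriv f vs differentiable (at x)"
  shows "smooth_on f U"
  using assms unfolding smooth_on_def Ck_on_def
  by (simp add: differentiable_at_withinI differentiable_imp_continuous_on differentiable_on_def)

text \<open>\<open>tangent_space\<close> asks for smooth curves, and images of lines under a chart
  are to serve as such. For a real variable the directions are numbers, so the iterated derivative
  is their product times the derivative of \<phi> taken \<open>length vs\<close> times along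
  \<open>w\<close>; differentiability is read off from this formula.\<close>

lemma smooth_on_compose_line:
  fixes \<phi> :: "'a::euclidean_space \<Rightarrow> 'b::real_normed_vector"
  assumes sm: "smooth_on \<phi> V" and V: "open V" and I: "open I"
    and sub: "\<And>t. t \<in> I \<Longrightarrow> u + t *\<^sub>R w \<in> V"
  shows "smooth_on (\<lambda>t::real. \<phi> (u + t *\<^sub>R w)) I"
proof -
  let ?\<gamma> = "\<lambda>t::real. \<phi> (u + t *\<^sub>R w)"
  have D: "((\<lambda>t. iter_deriv \<phi> ws (u + t *\<^sub>R w)) has_derivative
      (\<lambda>h. h *\<^sub>R iter_deriv \<phi> (w # ws) (u + t *\<^sub>R w))) (at t)" if "t \<in> I" for t ws
  proof -
    have g: "((\<lambda>t. u + t *\<^sub>R w) has_derivative (\<lambda>h. h *\<^sub>R w)) (at t)"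
      by (auto intro!: derivative_eq_intros)
    have "((\<lambda>t. iter_deriv \<phi> ws (u + t *\<^sub>R w)) has_derivative
      (\<lambda>h. iter_deriv \<phi> ((h *\<^sub>R w) # ws) (u + t *\<^sub>R w))) (at t)"
      using has_derivative_compose[OF g smooth_on_has_derivative[OF sm V sub[OF that]]] .
    moreover have "linear (\<lambda>v. iter_deriv \<phi> (v # ws) (u + t *\<^sub>R w))"
      using smooth_on_has_derivative[OF sm V sub[OF that]] has_derivative_linear by blast
    ultimately show ?thesis by (simp only: linear_scale[of "\<lambda>v. iter_deriv \<phi> (v # ws) (u + t *\<^sub>R w)"])
  qed
  have eq: "iter_deriv ?\<gamma> vs t = prod_list vs *\<^sub>R iter_deriv \<phi> (replicate (length vs) w) (u + t *\<^sub>R w)"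
    if "t \<in> I" for vs t
    using that
  proof (induction vs arbitrary: t)
    case (Cons h vs)
    have "((\<lambda>t. prod_list vs *\<^sub>R iter_deriv \<phi> (replicate (length vs) w) (u + t *\<^sub>R w)) has_derivative
       (\<lambda>h. prod_list vs *\<^sub>R (h *\<^sub>R iter_deriv \<phi> (w # replicate (length vs) w) (u + t *\<^sub>R w)))) (at t)"
      by (rule has_derivative_scaleR_right[OF D[OF Cons.prems]])
    then have "(iter_deriv ?\<gamma> vs has_derivative
       (\<lambda>h. prod_list vs *\<^sub>R (h *\<^sub>R iter_deriv \<phi> (w # replicate (length vs) w) (u + t *\<^sub>R w)))) (at t)"
      by (rule has_derivative_transform_within_open[OF _ I Cons.prems]) (simp add: Cons.IH)
    from frechet_derivative_at[OF this, symmetric] show ?case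
      by (simp add: iter_deriv.simps(2) mult.commute)
  qed (simp add: iter_deriv.simps)
  show ?thesis
  proof (rule smooth_onI[OF I])
    fix vs and t :: real assume t: "t \<in> I"
    have "((\<lambda>t. prod_list vs *\<^sub>R iter_deriv \<phi> (replicate (length vs) w) (u + t *\<^sub>R w)) has_derivative
       (\<lambda>h. prod_list vs *\<^sub>R (h *\<^sub>R iter_deriv \<phi> (w # replicate (length vs) w) (u + t *\<^sub>R w)))) (at t)"
      by (rule has_derivative_scaleR_right[OF D[OF t]])
    then have "(iter_deriv ?\<gamma> vs has_derivative
       (\<lambda>h. prod_list vs *\<^sub>R (h *\<^sub>R iter_deriv \<phi> (w # replicate (length vs) w) (u + t *\<^sub>R w)))) (at t)"
      by (rule has_derivative_transform_within_open[OF _ I t]) (simp add: eq)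
    then show "iter_deriv ?\<gamma> vs differentiable (at t)"
      by (rule differentiableI)
  qed
qed

section \<open>Second order calculus: the second derivative test and Schwarz's theorem\<close>

lemma second_derivative_test:
  fixes f f' :: "real \<Rightarrow> real"
  assumes "0 < d"
    and der: "\<And>t. \<bar>t\<bar> < d \<Longrightarrow> (f has_real_derivative f' t) (at t)"
    and der2: "(f' has_real_derivative l) (at 0)"
    and min: "\<And>t. \<bar>t\<bar> < d \<Longrightarrow> f 0 \<le> f t"
  shows "f' 0 = 0" "0 \<le> l"
proof -
  show f'0: "f' 0 = 0"
    using DERIV_local_min[OF der[of 0] \<open>0 < d\<close>] min \<open>0 < d\<close> by auto
  show "0 \<le> l"
  proof (rule ccontr)
    \<comment> \<open>A negative \<open>l\<close> together with \<open>f' 0 = 0\<close> makes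
      \<open>f'\<close> negative just to the right of 0; the mean value theorem on [0, b] then
      contradicts minimality.\<close>
    assume "\<not> 0 \<le> l"
    then obtain r where r: "0 < r" "\<And>h. 0 < h \<Longrightarrow> h < r \<Longrightarrow> f' h < f' 0"
      using DERIV_neg_dec_right[OF der2] by auto
    define b where "b = min r d / 2"
    have b: "0 < b" "b < r" "b < d"
      using r \<open>0 < d\<close> by (auto simp: b_def min_def)
    obtain z where "0 < z" "z < b" "f b - f 0 = b * f' z"
      using MVT2[of 0 b f f'] b der by auto
    with r b f'0 have "f b < f 0"
      by (smt (verit) mult_pos_neg)
    with min[of b] b show False by simp
  qed
qed

lemma Ck_on_continuous_iter_deriv:
  assumes "Ck_on k f U" "open U" "x \<in> U" "length vs \<le> k"
  shows "continuous (at x) (iter_deriv f vs)"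
  using assms unfolding Ck_on_def by (metis continuous_on_eq_continuous_at)

text \<open>Schwarz's theorem, by applying the mean value theorem twice to the mixed second difference.\<close>

lemma second_difference_mean_value:
  fixes f :: "'a::euclidean_space \<Rightarrow> real"
  assumes C: "Ck_on 2 f U" and U: "open U" and "0 < t"
    and sub: "\<And>a b. 0 \<le> a \<Longrightarrow> a \<le> t \<Longrightarrow> 0 \<le> b \<Longrightarrow> b \<le> t \<Longrightarrow> x + a *\<^sub>R u + b *\<^sub>R v \<in> U"
  obtains a b where "0 < a" "a < t" "0 < b" "b < t"
    "f (x + t *\<^sub>R u + t *\<^sub>R v) - f (x + t *\<^sub>R u) - f (x + t *\<^sub>R v) + f x
       = t\<^sup>2 * iter_deriv f [v, u] (x + a *\<^sub>R u + b *\<^sub>R v)"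
proof -
  have line: "((\<lambda>r. iter_deriv f vs (y + r *\<^sub>R w)) has_real_derivative
       iter_deriv f (w # vs) (y + r *\<^sub>R w)) (at r)"
    if "y + r *\<^sub>R w \<in> U" "length vs < 2" for vs y w and r :: real
  proof -
    have g: "((\<lambda>t. y + t *\<^sub>R w) has_derivative (\<lambda>h. h *\<^sub>R w)) (at r)"
      by (auto intro!: derivative_eq_intros)
    note D = Ck_on_has_derivative[OF C U that]
    have "linear (\<lambda>v. iter_deriv f (v # vs) (y + r *\<^sub>R w))"
      using D has_derivative_linear by blast
    from linear_scale[OF this, of _ w]
    have "(\<lambda>h. iter_deriv f (h *\<^sub>R w # vs) (y + r *\<^sub>R w)) = (*) (iter_deriv f (w # vs) (y + r *\<^sub>R w))"
      by (auto simp: fun_eq_iff)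
    then show ?thesis
      using has_derivative_compose[OF g D] unfolding has_field_derivative_def by (simp only:)
  qed
  have "((\<lambda>r. f (x + t *\<^sub>R v + r *\<^sub>R u) - f (x + r *\<^sub>R u)) has_real_derivative
      iter_deriv f [u] (x + t *\<^sub>R v + r *\<^sub>R u) - iter_deriv f [u] (x + r *\<^sub>R u)) (at r)"
    if "0 \<le> r" "r \<le> t" for r
    using line[of "x + t *\<^sub>R v" r u "[]"] line[of x r u "[]"] sub[of r t] sub[of r 0] that \<open>0 < t\<close>
    by (intro derivative_intros) (auto simp: algebra_simps iter_deriv.simps(1))
  from MVT2[OF \<open>0 < t\<close> this] obtain a where a: "0 < a" "a < t" and
    a': "(f (x + t *\<^sub>R v + t *\<^sub>R u) - f (x + t *\<^sub>R u)) - (f (x + t *\<^sub>R v) - f x)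
      = t * (iter_deriv f [u] (x + t *\<^sub>R v + a *\<^sub>R u) - iter_deriv f [u] (x + a *\<^sub>R u))"
    by auto
  have "((\<lambda>r. iter_deriv f [u] (x + a *\<^sub>R u + r *\<^sub>R v)) has_real_derivative
      iter_deriv f [v, u] (x + a *\<^sub>R u + r *\<^sub>R v)) (at r)" if "0 \<le> r" "r \<le> t" for r
    using line[of "x + a *\<^sub>R u" r v "[u]"] sub[of a r] that a by simp
  from MVT2[OF \<open>0 < t\<close> this] obtain b where b: "0 < b" "b < t" and
    b': "iter_deriv f [u] (x + a *\<^sub>R u + t *\<^sub>R v) - iter_deriv f [u] (x + a *\<^sub>R u)
      = t * iter_deriv f [v, u] (x + a *\<^sub>R u + b *\<^sub>R v)"
    by auto
  show thesis
    by (rule that[OF a b]) (use a' b' in \<open>simp add: algebra_simps power2_eq_square\<close>)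
qed

text \<open>The mixed second difference is symmetric in \<open>u\<close> and \<open>v\<close>, so it
  is t^2 times either mixed derivative, each taken at its own point near \<open>x\<close>.
  Continuity of both at \<open>x\<close> excludes different values.\<close>

lemma iter_deriv_commute:
  fixes f :: "'a::euclidean_space \<Rightarrow> real"
  assumes C: "Ck_on 2 f U" and U: "open U" and x: "x \<in> U"
  shows "iter_deriv f [u, v] x = iter_deriv f [v, u] x"
proof (rule ccontr)
  let ?e = "\<bar>iter_deriv f [u, v] x - iter_deriv f [v, u] x\<bar> / 2"
  assume ne: "iter_deriv f [u, v] x \<noteq> iter_deriv f [v, u] x"
  have near: "\<exists>d>0. \<forall>y. dist y x < d \<longrightarrow> \<bar>iter_deriv f vs y - iter_deriv f vs x\<bar> < ?e" if "length vs = 2" for vs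
  proof -
    have "0 < ?e" using ne by simp
    moreover have "continuous (at x) (iter_deriv f vs)"
      using Ck_on_continuous_iter_deriv[OF C U x] that by simp
    ultimately show ?thesis
      unfolding continuous_at_eps_delta dist_real_def by blast
  qed
  obtain d1 where d1: "0 < d1" "\<And>y. dist y x < d1 \<Longrightarrow> \<bar>iter_deriv f [u, v] y - iter_deriv f [u, v] x\<bar> < ?e"
    using near[of "[u, v]"] by auto
  obtain d2 where d2: "0 < d2" "\<And>y. dist y x < d2 \<Longrightarrow> \<bar>iter_deriv f [v, u] y - iter_deriv f [v, u] x\<bar> < ?e"
    using near[of "[v, u]"] by auto
  obtain d3 where d3: "0 < d3" "ball x d3 \<subseteq> U"
    using U x open_contains_ball by blast
  define d where "d = min d1 (min d2 d3)"
  have d: "0 < d" "d \<le> d1" "d \<le> d2" "d \<le> d3"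
    using d1 d2 d3 by (auto simp: d_def)
  \<comment> \<open>Small enough that the whole parallelogram with sides t u and t v stays within d
    / 2 of \<open>x\<close>; the summand 1 keeps the denominator positive when both directions
    vanish.\<close>
  define t where "t = d / (2 * (norm u + norm v + 1))"
  have pos: "0 < norm u + norm v + 1"
    by (simp add: add_nonneg_pos)
  have t: "0 < t"
    using d pos by (simp add: t_def)
  have small: "dist (x + a *\<^sub>R u' + b *\<^sub>R v') x < d"
    if "0 \<le> a" "a \<le> t" "0 \<le> b" "b \<le> t" "u' = u \<and> v' = v \<or> u' = v \<and> v' = u" for a b u' v'
  proof -
    have "dist (x + a *\<^sub>R u' + b *\<^sub>R v') x \<le> a * norm u' + b * norm v'"
      using that norm_triangle_ineq[of "a *\<^sub>R u'" "b *\<^sub>R v'"] by (simp add: dist_norm algebra_simps)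
    also have "\<dots> \<le> t * norm u' + t * norm v'"
      using that by (intro add_mono mult_right_mono) auto
    also have "\<dots> \<le> t * (norm u + norm v + 1)"
      using that t by (auto simp: algebra_simps)
    also have "\<dots> = d / 2"
    proof -
      have "d / (2 * N) * N = d / 2" if "0 < N" for N using that by simp
      from this[OF pos] show ?thesis by (simp only: t_def)
    qed
    finally show ?thesis using d by simp
  qed
  have inU: "x + a *\<^sub>R u' + b *\<^sub>R v' \<in> U"
    if "0 \<le> a" "a \<le> t" "0 \<le> b" "b \<le> t" "u' = u \<and> v' = v \<or> u' = v \<and> v' = u" for a b u' v'
    using small[OF that] d d3 by (force simp: dist_commute)
  obtain a b where ab: "0 < a" "a < t" "0 < b" "b < t"
    "f (x + t *\<^sub>R u + t *\<^sub>R v) - f (x + t *\<^sub>R u) - f (x + t *\<^sub>R v) + f x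
       = t\<^sup>2 * iter_deriv f [v, u] (x + a *\<^sub>R u + b *\<^sub>R v)"
    by (rule second_difference_mean_value[OF C U t, of x u v]) (auto intro!: inU)
  obtain a' b' where ab': "0 < a'" "a' < t" "0 < b'" "b' < t"
    "f (x + t *\<^sub>R v + t *\<^sub>R u) - f (x + t *\<^sub>R v) - f (x + t *\<^sub>R u) + f x
       = t\<^sup>2 * iter_deriv f [u, v] (x + a' *\<^sub>R v + b' *\<^sub>R u)"
    by (rule second_difference_mean_value[OF C U t, of x v u]) (auto intro!: inU)
  have "iter_deriv f [v, u] (x + a *\<^sub>R u + b *\<^sub>R v) = iter_deriv f [u, v] (x + a' *\<^sub>R v + b' *\<^sub>R u)"
    using ab(5) ab'(5) t by (simp add: algebra_simps)
  moreover have "\<bar>iter_deriv f [v, u] (x + a *\<^sub>R u + b *\<^sub>R v) - iter_deriv f [v, u] x\<bar> < ?e"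
    using small[of a b u v] ab d by (intro d2) auto
  moreover have "\<bar>iter_deriv f [u, v] (x + a' *\<^sub>R v + b' *\<^sub>R u) - iter_deriv f [u, v] x\<bar> < ?e"
    using small[of a' b' v u] ab' d by (intro d1) auto
  ultimately show False by (smt (verit, best) field_sum_of_halves)
qed

section \<open>Touching from one side in a chart\<close>

unbundle cross3_syntax

lemma iter_deriv_Nil [simp]: "iter_deriv f [] = f"
  by (rule ext) (simp add: iter_deriv.simps)

text \<open>The trace of a product of two nonnegative forms is nonnegative. As \<open>A\<close> is
  symmetric, \<open>M\<close> enters through its quadratic form alone, and completing the square in
  dimension two suffices.\<close>

lemma trace_product_nonneg:
  fixes A M :: "'a::real_vector \<Rightarrow> 'a \<Rightarrow> real"
  assumes A: "bilinear A" and M: "bilinear M" and "card B = 2"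
    and sym: "\<And>x y. A x y = A y x"
    and Apos: "\<And>x. x \<in> span B \<Longrightarrow> 0 \<le> A x x"
    and Apos': "\<And>x. x \<in> B \<Longrightarrow> 0 < A x x"
    and Mpos: "\<And>x. x \<in> span B \<Longrightarrow> 0 \<le> M x x"
  shows "0 \<le> (\<Sum>\<sigma>\<in>B. \<Sum>\<tau>\<in>B. A \<sigma> \<tau> * M \<sigma> \<tau>)"
proof -
  obtain b d where B: "B = {b, d}" "b \<noteq> d"
    using \<open>card B = 2\<close> by (auto simp: card_2_iff)
  let ?S = "A b b * M b b + A b d * M b d + (A b d * M d b + A d d * M d d)"
  have sp: "x *\<^sub>R b + y *\<^sub>R d \<in> span B" for x y
    by (simp add: B span_add span_mul span_base)
  have pos: "0 < A b b" using Apos' B by simp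
  have expand: "bilinear N \<Longrightarrow> N (x *\<^sub>R b + y *\<^sub>R d) (x *\<^sub>R b + y *\<^sub>R d)
      = x\<^sup>2 * N b b + x * y * (N b d + N d b) + y\<^sup>2 * N d d" for N :: "'a \<Rightarrow> 'a \<Rightarrow> real" and x y
    by (simp add: bilinear_ladd bilinear_radd bilinear_lmul bilinear_rmul power2_eq_square algebra_simps)
  \<comment> \<open>This vector is A-orthogonal to \<open>b\<close>; evaluating the form on it gives
    the determinant of \<open>A\<close> up to the factor \<open>A b b\<close>.\<close>
  have "0 \<le> A ((- A b d) *\<^sub>R b + A b b *\<^sub>R d) ((- A b d) *\<^sub>R b + A b b *\<^sub>R d)"
    by (rule Apos[OF sp])
  also have "\<dots> = A b b * (A b b * A d d - (A b d)\<^sup>2)"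
    unfolding expand[OF A] sym[of d b] by (simp add: power2_eq_square algebra_simps)
  finally have det: "0 \<le> A b b * A d d - (A b d)\<^sup>2"
    using pos by (simp add: zero_le_mult_iff)
  \<comment> \<open>The completed square: this sum of two nonnegative terms equals
    \<open>A b b\<close> times the trace.\<close>
  have "0 \<le> M (A b b *\<^sub>R b + A b d *\<^sub>R d) (A b b *\<^sub>R b + A b d *\<^sub>R d)
      + (A b b * A d d - (A b d)\<^sup>2) * M d d"
    using Mpos[OF sp] det Mpos[of d] B by (intro add_nonneg_nonneg mult_nonneg_nonneg) (auto simp: span_base)
  also have "\<dots> = A b b * ?S"
    unfolding expand[OF M] by (simp add: power2_eq_square algebra_simps)
  finally have "0 \<le> ?S"
    using pos by (simp add: zero_le_mult_iff)
  then show ?thesis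
    using B by (simp add: sym[of d b])
qed

section \<open>Tangent plane, normal field and second fundamental form in a chart\<close>

locale surface_chart =
  fixes \<Sigma> :: "(real^3) set" and \<nu> :: "real^3 \<Rightarrow> real^3"
    and U :: "(real^3) set" and V :: "(real^2) set" and \<phi> \<psi>
  assumes normal: "unit_normal \<Sigma> \<nu>"
    and open_U: "open U" and open_V: "open V"
    and homeo: "homeomorphism V (\<Sigma> \<inter> U) \<phi> \<psi>"
    and smooth: "smooth_on \<phi> V"
    and immersion: "\<And>u. u \<in> V \<Longrightarrow> inj (frechet_derivative \<phi> (at u))"
begin

lemma chart_in: "u \<in> V \<Longrightarrow> \<phi> u \<in> \<Sigma>" "u \<in> V \<Longrightarrow> \<phi> u \<in> U"
  using homeo by (auto simp: homeomorphism_def)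

lemma deriv_chart:
  assumes "u \<in> V"
  shows "(\<phi> has_derivative (\<lambda>w. iter_deriv \<phi> [w] u)) (at u)"
  using smooth_on_has_derivative[OF smooth open_V assms, of "[]"] by simp

lemma deriv2_chart:
  assumes "u \<in> V"
  shows "(iter_deriv \<phi> [w] has_derivative (\<lambda>v. iter_deriv \<phi> [v, w] u)) (at u)"
  using smooth_on_has_derivative[OF smooth open_V assms] .

lemma linear_chart: "u \<in> V \<Longrightarrow> linear (\<lambda>w. iter_deriv \<phi> [w] u)"
  using deriv_chart has_derivative_linear by blast

lemma inj_chart: "u \<in> V \<Longrightarrow> inj (\<lambda>w. iter_deriv \<phi> [w] u)"
  using immersion[of u] frechet_derivative_at[OF deriv_chart] by simp

lemma line_in_chart:
  assumes "u \<in> V"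
  obtains e where "0 < e" "\<And>t. \<bar>t\<bar> < e \<Longrightarrow> u + t *\<^sub>R w \<in> V"
proof -
  obtain d where d: "0 < d" "ball u d \<subseteq> V"
    using open_V assms open_contains_ball by blast
  have pos: "0 < norm w + 1" by (simp add: add_nonneg_pos)
  show thesis
  proof (rule that)
    show "0 < d / (norm w + 1)" using d pos by simp
    fix t assume "\<bar>t\<bar> < d / (norm w + 1)"
    then have "\<bar>t\<bar> * (norm w + 1) < d" using pos by (simp add: pos_less_divide_eq)
    then have "\<bar>t\<bar> * norm w < d" by (simp add: algebra_simps)
    then show "u + t *\<^sub>R w \<in> V" using d by (auto simp: dist_norm)
  qed
qed

lemma line_derivative:
  assumes "u + t *\<^sub>R w \<in> V"
  shows "((\<lambda>t. \<phi> (u + t *\<^sub>R w)) has_vector_derivative iter_deriv \<phi> [w] (u + t *\<^sub>R w)) (at t)"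
    and "((\<lambda>t. iter_deriv \<phi> [w] (u + t *\<^sub>R w)) has_vector_derivative iter_deriv \<phi> [w, w] (u + t *\<^sub>R w)) (at t)"
proof -
  have line: "((\<lambda>t. iter_deriv \<phi> ws (u + t *\<^sub>R w)) has_vector_derivative iter_deriv \<phi> (w # ws) (u + t *\<^sub>R w)) (at t)"
    for ws
  proof -
    have g: "((\<lambda>t. u + t *\<^sub>R w) has_derivative (\<lambda>h. h *\<^sub>R w)) (at t)"
      by (auto intro!: derivative_eq_intros)
    note D = smooth_on_has_derivative[OF smooth open_V assms, of ws]
    have "linear (\<lambda>v. iter_deriv \<phi> (v # ws) (u + t *\<^sub>R w))"
      using D has_derivative_linear by blast
    from linear_scale[OF this, of _ w] show ?thesis
      using has_derivative_compose[OF g D] unfolding has_vector_derivative_def by simp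
  qed
  show "((\<lambda>t. \<phi> (u + t *\<^sub>R w)) has_vector_derivative iter_deriv \<phi> [w] (u + t *\<^sub>R w)) (at t)"
    using line[of "[]"] by simp
  show "((\<lambda>t. iter_deriv \<phi> [w] (u + t *\<^sub>R w)) has_vector_derivative iter_deriv \<phi> [w, w] (u + t *\<^sub>R w)) (at t)"
    by (rule line)
qed

lemma tangent_chart:
  assumes u: "u \<in> V"
  shows "iter_deriv \<phi> [w] u \<in> tangent_space \<Sigma> (\<phi> u)"
proof -
  obtain e where e: "0 < e" "\<And>t. \<bar>t\<bar> < e \<Longrightarrow> u + t *\<^sub>R w \<in> V"
    using line_in_chart[OF u] by blast
  have "smooth_on (\<lambda>t. \<phi> (u + t *\<^sub>R w)) {-e<..<e}"
    using e by (intro smooth_on_compose_line[OF smooth open_V]) auto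
  moreover have "(\<lambda>t. \<phi> (u + t *\<^sub>R w)) ` {-e<..<e} \<subseteq> \<Sigma>"
    using e chart_in by auto
  moreover have "((\<lambda>t. \<phi> (u + t *\<^sub>R w)) has_vector_derivative iter_deriv \<phi> [w] u) (at 0)"
    using line_derivative(1)[of u 0 w] u by simp
  ultimately show ?thesis
    unfolding tangent_space_def using \<open>0 < e\<close> by force
qed

lemma norm_normal: "u \<in> V \<Longrightarrow> norm (\<nu> (\<phi> u)) = 1"
  using normal chart_in by (simp add: unit_normal_def)

lemma normal_orthogonal: "u \<in> V \<Longrightarrow> \<nu> (\<phi> u) \<bullet> iter_deriv \<phi> [w] u = 0"
  using normal chart_in tangent_chart by (simp add: unit_normal_def)

text \<open>A sandwich: the range of the differential lies in the tangent space, which lies in the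
  orthogonal complement of the normal, and the two outer spaces both have dimension 2.\<close>

lemma
  assumes u: "u \<in> V"
  shows tangent_space_range: "tangent_space \<Sigma> (\<phi> u) = range (\<lambda>w. iter_deriv \<phi> [w] u)"
    and tangent_space_normal: "tangent_space \<Sigma> (\<phi> u) = {v. \<nu> (\<phi> u) \<bullet> v = 0}"
proof -
  let ?D = "\<lambda>w. iter_deriv \<phi> [w] u" and ?P = "{v. \<nu> (\<phi> u) \<bullet> v = 0}"
  have "\<nu> (\<phi> u) \<noteq> 0" using norm_normal[OF u] by auto
  then have "dim ?P = 2"
    by (simp add: dim_hyperplane)
  moreover have "dim (range ?D) = 2"
    using dim_image_eq[OF linear_chart[OF u], of UNIV] inj_chart[OF u] by simp
  moreover have "range ?D \<subseteq> ?P" using normal_orthogonal[OF u] by auto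
  ultimately have "range ?D = ?P"
    using linear_subspace_image[OF linear_chart[OF u] subspace_UNIV]
    by (intro subspace_dim_equal) (auto simp: subspace_hyperplane)
  moreover have "range ?D \<subseteq> tangent_space \<Sigma> (\<phi> u)"
    using tangent_chart[OF u] by auto
  moreover have "tangent_space \<Sigma> (\<phi> u) \<subseteq> ?P"
    using normal chart_in[OF u] by (auto simp: unit_normal_def)
  ultimately show "tangent_space \<Sigma> (\<phi> u) = range ?D" "tangent_space \<Sigma> (\<phi> u) = ?P"
    by auto
qed

text \<open>An unnormalized normal built from the chart alone. It is differentiable, and through it
  the normal \<nu>, which is only assumed continuous, becomes differentiable.\<close>

definition chart_cross :: "real^2 \<Rightarrow> real^3" where
  "chart_cross u = iter_deriv \<phi> [axis 1 1] u \<times> iter_deriv \<phi> [axis 2 1] u"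

text \<open>By the formula for the double cross product, ?a \<times> (?a \<times> ?b) is the image
  of \<open>?w\<close> under the differential, so a vanishing cross product contradicts
  injectivity.\<close>

lemma chart_cross_nonzero:
  assumes u: "u \<in> V" shows "chart_cross u \<noteq> 0"
proof
  let ?a = "iter_deriv \<phi> [axis 1 1] u" and ?b = "iter_deriv \<phi> [axis 2 1] u"
  let ?w = "(?a \<bullet> ?b) *\<^sub>R axis 1 1 - (?a \<bullet> ?a) *\<^sub>R axis 2 1 :: real^2"
  assume "chart_cross u = 0"
  then have "?a \<times> (?a \<times> ?b) = 0" by (simp add: chart_cross_def)
  then have "iter_deriv \<phi> [?w] u = 0"
    by (simp add: Lagrange linear_diff[OF linear_chart[OF u]] linear_scale[OF linear_chart[OF u]])
  then have "?w = 0"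
    using inj_chart[OF u] linear_chart[OF u] by (auto simp: linear_injective_0)
  then have "?a \<bullet> ?a = 0"
    by (simp add: vec_eq_iff axis_def forall_2)
  then have "?a = 0" by simp
  then have "axis 1 1 = (0 :: real^2)"
    using inj_chart[OF u] linear_chart[OF u] by (auto simp: linear_injective_0)
  then show False by (simp add: axis_eq_0_iff)
qed

lemma chart_cross_normal:
  assumes u: "u \<in> V"
  shows "chart_cross u = (\<nu> (\<phi> u) \<bullet> chart_cross u) *\<^sub>R \<nu> (\<phi> u)"
proof -
  have "\<nu> (\<phi> u) \<times> chart_cross u = 0"
    using normal_orthogonal[OF u] by (simp add: chart_cross_def Lagrange)
  then have "\<nu> (\<phi> u) \<times> (\<nu> (\<phi> u) \<times> chart_cross u) = 0" by simp
  then show ?thesis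
    using norm_normal[OF u] by (simp add: Lagrange norm_eq_1)
qed

lemma chart_cross_differentiable:
  assumes u: "u \<in> V" shows "chart_cross differentiable (at u)"
proof -
  have "bounded_bilinear (\<times>)"
    using bilinear_cross bilinear_conv_bounded_bilinear by blast
  from bounded_bilinear.FDERIV[OF this deriv2_chart[OF u] deriv2_chart[OF u]]
  show ?thesis
    unfolding chart_cross_def[abs_def] by (rule differentiableI)
qed

text \<open>Near a point the normal is the normalized cross product up to a locally constant sign.\<close>

lemma normal_chart_differentiable:
  assumes u: "u \<in> V" shows "(\<lambda>v. \<nu> (\<phi> v)) differentiable (at u)"
proof -
  let ?n = chart_cross and ?h = "\<lambda>v. \<nu> (\<phi> v) \<bullet> chart_cross v"
  define s where "s = sgn (?h u)"
  have cont_n: "continuous_on V ?n"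
    using chart_cross_differentiable differentiable_imp_continuous_within
    by (metis continuous_at_imp_continuous_on)
  have cont_nu: "continuous_on V (\<lambda>v. \<nu> (\<phi> v))"
  proof (rule continuous_on_compose2[of \<Sigma> \<nu> V \<phi>])
    show "continuous_on \<Sigma> \<nu>" using normal by (simp add: unit_normal_def)
    show "continuous_on V \<phi>" using homeo by (simp add: homeomorphism_def)
    show "\<phi> ` V \<subseteq> \<Sigma>" using chart_in by auto
  qed
  have "continuous_on V (\<lambda>v. s * ?h v)"
    using cont_n cont_nu by (intro continuous_intros)
  then have W: "open (V \<inter> (\<lambda>v. s * ?h v) -` {0<..})"
    using open_V by (simp add: continuous_on_open_vimage open_Int Int_commute)
  have nz: "?h v \<noteq> 0" if "v \<in> V" for v
    using chart_cross_normal[OF that] chart_cross_nonzero[OF that] by auto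
  have eq: "s *\<^sub>R (inverse (norm (?n v)) *\<^sub>R ?n v) = \<nu> (\<phi> v)" if v: "v \<in> V" "0 < s * ?h v" for v
  proof -
    have "norm (?n v) = \<bar>?h v\<bar>"
      by (subst chart_cross_normal[OF v(1)]) (simp add: norm_normal[OF v(1)])
    moreover have "s = sgn (?h v)"
      using v(2) nz[OF u] unfolding s_def by (auto simp: sgn_if zero_less_mult_iff split: if_splits)
    ultimately have "s * (inverse (norm (?n v)) * ?h v) = 1"
      using nz[OF v(1)] by (auto simp: sgn_if)
    then show ?thesis
      by (subst (2) chart_cross_normal[OF v(1)]) simp
  qed
  obtain n' where n': "(?n has_derivative n') (at u)"
    using chart_cross_differentiable[OF u] by (auto simp: differentiable_def)
  have norm': "((\<lambda>v. norm (?n v)) has_derivative (\<lambda>h. n' h \<bullet> sgn (?n u))) (at u)"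
    using has_derivative_compose[OF n' has_derivative_norm[OF chart_cross_nonzero[OF u]]] .
  have "\<exists>D. ((\<lambda>v. s *\<^sub>R (inverse (norm (?n v)) *\<^sub>R ?n v)) has_derivative D) (at u)"
    using chart_cross_nonzero[OF u] by (auto intro!: exI derivative_eq_intros n' norm')
  then obtain D where "((\<lambda>v. s *\<^sub>R (inverse (norm (?n v)) *\<^sub>R ?n v)) has_derivative D) (at u)" ..
  then have "((\<lambda>v. \<nu> (\<phi> v)) has_derivative D) (at u)"
  proof (rule has_derivative_transform_within_open[OF _ W])
    show "u \<in> V \<inter> (\<lambda>v. s * ?h v) -` {0<..}"
      using u nz[OF u] by (auto simp: s_def sgn_if)
  qed (use eq in auto)
  then show ?thesis by (rule differentiableI)
qed

text \<open>The derivative within \<Sigma> is unique on tangent vectors only, so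
  \<open>frechet_derivative\<close> makes a choice; the point is that this choice is a derivative.
  Existence comes from writing \<nu> on \<Sigma> \<inter> U as (\<nu> o \<phi>) o \<psi>.\<close>

lemma normal_differentiable:
  assumes u: "u \<in> V"
  shows "(\<nu> has_derivative frechet_derivative \<nu> (at (\<phi> u) within \<Sigma>)) (at (\<phi> u) within \<Sigma>)"
proof -
  have im: "\<phi> ` V = \<Sigma> \<inter> U" and inv: "\<And>v. v \<in> V \<Longrightarrow> \<psi> (\<phi> v) = v"
    and inv': "\<And>x. x \<in> \<Sigma> \<inter> U \<Longrightarrow> \<phi> (\<psi> x) = x"
    and cont: "continuous_on (\<Sigma> \<inter> U) \<psi>"
    using homeo by (auto simp: homeomorphism_def)
  \<comment> \<open>Any linear left inverse of the differential of \<phi> serves as a derivative of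
    \<psi> within \<Sigma>.\<close>
  obtain L where L: "linear L" "L \<circ> (\<lambda>w. iter_deriv \<phi> [w] u) = id"
    using linear_injective_left_inverse[OF linear_chart[OF u] inj_chart[OF u]] by blast
  have "(\<psi> has_derivative L) (at (\<phi> u) within \<phi> ` V)"
  proof (rule has_derivative_inverse_within[OF _ _ u L inv])
    show "(\<phi> has_derivative (\<lambda>w. iter_deriv \<phi> [w] u)) (at u within V)"
      using deriv_chart[OF u] has_derivative_at_withinI by blast
    show "continuous (at (\<phi> u) within \<phi> ` V) \<psi>"
      using cont u im by (simp add: continuous_on_eq_continuous_within image_iff) (metis imageI)
  qed
  moreover obtain N where "((\<lambda>v. \<nu> (\<phi> v)) has_derivative N) (at (\<psi> (\<phi> u)))"
    using normal_chart_differentiable[OF u] inv[OF u] by (auto simp: differentiable_def)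
  ultimately have "((\<lambda>x. \<nu> (\<phi> (\<psi> x))) has_derivative (\<lambda>x. N (L x))) (at (\<phi> u) within \<phi> ` V)"
    by (rule has_derivative_compose)
  then have "(\<nu> has_derivative (\<lambda>x. N (L x))) (at (\<phi> u) within \<phi> ` V)"
    by (rule has_derivative_transform[rotated 2]) (use u inv' im in auto)
  moreover have "at (\<phi> u) within \<phi> ` V = at (\<phi> u) within \<Sigma>"
    using chart_in[OF u] by (intro at_within_nhd[OF _ open_U]) (auto simp: im)
  ultimately show ?thesis
    by (metis frechet_derivative_works differentiableI)
qed

text \<open>Differentiate the identity \<nu>(c(t)) \<bullet> c'(t) = 0 at t = 0 along the curve c(t)
  = \<phi>(u + t w).\<close>

lemma second_fundamental_form_chart:
  assumes u: "u \<in> V"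
  shows "second_fundamental_form \<Sigma> \<nu> (\<phi> u) (iter_deriv \<phi> [w] u) (iter_deriv \<phi> [w] u)
    = \<nu> (\<phi> u) \<bullet> iter_deriv \<phi> [w, w] u"
proof -
  let ?c = "\<lambda>t. \<phi> (u + t *\<^sub>R w)" and ?c' = "\<lambda>t. iter_deriv \<phi> [w] (u + t *\<^sub>R w)"
  let ?dn = "frechet_derivative \<nu> (at (\<phi> u) within \<Sigma>)"
  obtain e where e: "0 < e" "\<And>t. \<bar>t\<bar> < e \<Longrightarrow> u + t *\<^sub>R w \<in> V"
    using line_in_chart[OF u] by blast
  define I where "I = {-e<..<e}"
  have I: "open I" "0 \<in> I"
    using e(1) by (auto simp: I_def)
  have cI: "?c ` I \<subseteq> \<Sigma>"
    using e(2) chart_in(1) by (force simp: I_def abs_less_iff)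
  have at_I: "at 0 within I = at 0"
    by (rule at_within_open[OF I(2,1)])
  have c: "(?c has_derivative (\<lambda>h. h *\<^sub>R iter_deriv \<phi> [w] u)) (at 0 within I)"
    using line_derivative(1)[of u 0 w] u
    by (simp add: has_vector_derivative_def has_derivative_at_withinI)
  have c': "(?c' has_derivative (\<lambda>h. h *\<^sub>R iter_deriv \<phi> [w, w] u)) (at 0 within I)"
    using line_derivative(2)[of u 0 w] u
    by (simp add: has_vector_derivative_def has_derivative_at_withinI)
  have nd: "(\<nu> has_derivative ?dn) (at (\<phi> u) within \<Sigma>)" by (rule normal_differentiable[OF u])
  \<comment> \<open>The derivative of \<nu> is available only within \<Sigma>, so the chain rule is
    applied within the image of the curve.\<close>
  have "(\<nu> has_derivative ?dn) (at (?c 0) within ?c ` I)"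
    using has_derivative_subset[OF nd cI] by simp
  from has_derivative_inner[OF has_derivative_in_compose[OF c this] c']
  have "((\<lambda>t. \<nu> (?c t) \<bullet> ?c' t) has_derivative
      (\<lambda>h. \<nu> (\<phi> u) \<bullet> (h *\<^sub>R iter_deriv \<phi> [w, w] u) + ?dn (h *\<^sub>R iter_deriv \<phi> [w] u) \<bullet> iter_deriv \<phi> [w] u)) (at 0)"
    (is "(_ has_derivative ?E) _") by (simp add: at_I)
  moreover have "((\<lambda>t. \<nu> (?c t) \<bullet> ?c' t) has_derivative (\<lambda>h. 0)) (at 0)"
  proof (rule has_derivative_transform_within_open[OF has_derivative_const I])
    fix t assume "t \<in> I"
    then have "\<bar>t\<bar> < e" by (simp add: I_def abs_less_iff)
    then show "0 = \<nu> (?c t) \<bullet> ?c' t"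
      using normal_orthogonal[OF e(2)] by simp
  qed
  ultimately have "?E = (\<lambda>h. 0)" by (rule has_derivative_unique)
  from fun_cong[OF this, of 1] show ?thesis
    by (simp add: second_fundamental_form_def)
qed

text \<open>Apply the second derivative test to \<open>F\<close> along c(t) = \<phi>(u + t w). The
  second derivative at 0 is H X \<bullet> X plus the gradient paired with c''(0). Since the gradient
  is a multiple of the normal, the latter term is that multiple of the second fundamental
  form.\<close>

lemma touching_second_order:
  assumes u: "u \<in> V" and W: "open W" "\<phi> u \<in> W"
    and F: "\<And>x. x \<in> W \<Longrightarrow> (F has_derivative (\<lambda>h. \<xi> x \<bullet> h)) (at x)"
    and H: "(\<xi> has_derivative H) (at (\<phi> u))"
    and min: "\<And>x. x \<in> \<Sigma> \<Longrightarrow> x \<in> W \<Longrightarrow> F (\<phi> u) \<le> F x"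
    and X: "X \<in> tangent_space \<Sigma> (\<phi> u)"
  shows "\<xi> (\<phi> u) = (\<xi> (\<phi> u) \<bullet> \<nu> (\<phi> u)) *\<^sub>R \<nu> (\<phi> u)"
    and "0 \<le> H X \<bullet> X + (\<xi> (\<phi> u) \<bullet> \<nu> (\<phi> u)) * second_fundamental_form \<Sigma> \<nu> (\<phi> u) X X"
proof -
  let ?p = "\<phi> u" and ?D = "\<lambda>w. iter_deriv \<phi> [w] u"
  have *: "\<xi> ?p \<bullet> ?D w = 0 \<and> 0 \<le> \<xi> ?p \<bullet> iter_deriv \<phi> [w, w] u + H (?D w) \<bullet> ?D w" for w
  proof -
    let ?c = "\<lambda>t. \<phi> (u + t *\<^sub>R w)" and ?c' = "\<lambda>t. iter_deriv \<phi> [w] (u + t *\<^sub>R w)"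
    let ?V = "V \<inter> \<phi> -` W"
    have "open ?V"
      using homeo open_V W by (simp add: homeomorphism_def continuous_on_open_vimage Int_commute)
    then obtain d where d: "0 < d" "ball u d \<subseteq> ?V"
      using u W open_contains_ball by (metis IntI vimageI)
    have pos: "0 < norm w + 1" by (simp add: add_nonneg_pos)
    define e where "e = d / (norm w + 1)"
    have e: "0 < e" using d pos by (simp add: e_def)
    have inV: "u + t *\<^sub>R w \<in> ?V" if "\<bar>t\<bar> < e" for t
    proof -
      have "\<bar>t\<bar> * (norm w + 1) < d" using that pos by (simp add: e_def pos_less_divide_eq)
      then have "\<bar>t\<bar> * norm w < d" by (simp add: algebra_simps)
      then show ?thesis using d by (auto simp: dist_norm subset_iff)
    qed
    have der: "((\<lambda>t. F (?c t)) has_real_derivative \<xi> (?c t) \<bullet> ?c' t) (at t)" if "\<bar>t\<bar> < e" for t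
    proof -
      have "(?c has_derivative (\<lambda>h. h *\<^sub>R ?c' t)) (at t)"
        using line_derivative(1) inV[OF that] by (simp add: has_vector_derivative_def)
      from has_derivative_compose[OF this F] inV[OF that]
      have "((\<lambda>t. F (?c t)) has_derivative (\<lambda>h. \<xi> (?c t) \<bullet> (h *\<^sub>R ?c' t))) (at t)" by simp
      then show ?thesis
        by (rule has_derivative_imp_has_field_derivative) simp
    qed
    have c: "(?c has_derivative (\<lambda>h. h *\<^sub>R ?D w)) (at 0)"
      using line_derivative(1)[of u 0 w] u by (simp add: has_vector_derivative_def)
    have c': "(?c' has_derivative (\<lambda>h. h *\<^sub>R iter_deriv \<phi> [w, w] u)) (at 0)"
      using line_derivative(2)[of u 0 w] u by (simp add: has_vector_derivative_def)
    have "(\<xi> has_derivative H) (at (?c 0))" using H by simp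
    from has_derivative_inner[OF has_derivative_compose[OF c this] c']
    have "((\<lambda>t. \<xi> (?c t) \<bullet> ?c' t) has_derivative
        (\<lambda>h. \<xi> ?p \<bullet> (h *\<^sub>R iter_deriv \<phi> [w, w] u) + H (h *\<^sub>R ?D w) \<bullet> ?D w)) (at 0)" by simp
    moreover have "linear H" using H has_derivative_linear by blast
    ultimately have der2: "((\<lambda>t. \<xi> (?c t) \<bullet> ?c' t) has_real_derivative
        (\<xi> ?p \<bullet> iter_deriv \<phi> [w, w] u + H (?D w) \<bullet> ?D w)) (at 0)"
      by (intro has_derivative_imp_has_field_derivative) (auto simp: linear_scale algebra_simps)
    have "F (?c 0) \<le> F (?c t)" if "\<bar>t\<bar> < e" for t
      using min[of "?c t"] inV[OF that] chart_in by simp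
    from second_derivative_test[OF e der der2 this] show ?thesis by simp
  qed
  \<comment> \<open>\<open>?r\<close> is the tangential part of the gradient. It is a tangent
    vector, so the first order condition makes it orthogonal to the gradient and hence to
    itself.\<close>
  let ?s = "\<xi> ?p \<bullet> \<nu> ?p" and ?r = "\<xi> ?p - (\<xi> ?p \<bullet> \<nu> ?p) *\<^sub>R \<nu> ?p"
  have "\<nu> ?p \<bullet> ?r = 0"
    using norm_normal[OF u] by (simp add: inner_diff_right norm_eq_1 inner_commute)
  then have "?r \<in> range ?D"
    using tangent_space_range[OF u] tangent_space_normal[OF u] by blast
  then have "\<xi> ?p \<bullet> ?r = 0" using * by auto
  with \<open>\<nu> ?p \<bullet> ?r = 0\<close> have "?r \<bullet> ?r = 0"
    by (simp add: inner_diff_left)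
  then show eq: "\<xi> ?p = ?s *\<^sub>R \<nu> ?p" by simp
  obtain w where w: "X = ?D w"
    using X tangent_space_range[OF u] by auto
  have "\<xi> ?p \<bullet> iter_deriv \<phi> [w, w] u = ?s * second_fundamental_form \<Sigma> \<nu> ?p X X"
    unfolding w second_fundamental_form_chart[OF u] by (subst eq) simp
  then show "0 \<le> H X \<bullet> X + ?s * second_fundamental_form \<Sigma> \<nu> ?p X X"
    using *[of w] w by simp
qed

end

section \<open>The touching principle for the anisotropic trace\<close>

lemma Ck_on_mono: "Ck_on k f U \<Longrightarrow> j \<le> k \<Longrightarrow> Ck_on j f U"
  unfolding Ck_on_def by (meson le_trans less_le_trans)

section \<open>The Hessian of a homogeneous even function\<close>

lemma bilinear_iter_deriv:
  fixes f :: "'a::euclidean_space \<Rightarrow> real"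
  assumes C: "Ck_on 2 f U" and U: "open U" and x: "x \<in> U"
  shows "bilinear (\<lambda>\<sigma> \<tau>. iter_deriv f [\<sigma>, \<tau>] x)"
proof -
  have 1: "linear (\<lambda>\<sigma>. iter_deriv f [\<sigma>, \<tau>] x)" for \<tau>
    using Ck_on_has_derivative[OF C U x, of "[\<tau>]"] has_derivative_linear by auto
  have "linear (\<lambda>\<tau>. iter_deriv f [\<sigma>, \<tau>] x)" for \<sigma>
    using 1[of \<sigma>] iter_deriv_commute[OF C U x] by simp
  with 1 show ?thesis by (simp add: bilinear_def)
qed

text \<open>Differentiate f (t y) = t f(y) in y and cancel the factor t.\<close>

lemma gradient_homogeneous:
  fixes f :: "'a::euclidean_space \<Rightarrow> real"
  assumes C: "Ck_on 1 f (- {0})" and hom: "\<And>t z. 0 \<le> t \<Longrightarrow> f (t *\<^sub>R z) = t * f z"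
    and "0 < t" "x \<noteq> 0"
  shows "iter_deriv f [\<tau>] (t *\<^sub>R x) = iter_deriv f [\<tau>] x"
proof -
  have D: "(f has_derivative (\<lambda>v. iter_deriv f [v] y)) (at y)" if "y \<noteq> 0" for y
    using Ck_on_has_derivative[OF C, of y "[]"] that by (simp add: open_Compl)
  have "((\<lambda>y. t *\<^sub>R y) has_derivative (\<lambda>h. t *\<^sub>R h)) (at x)"
    by (auto intro!: derivative_eq_intros)
  from has_derivative_compose[OF this D[of "t *\<^sub>R x"]]
  have "((\<lambda>y. t * f y) has_derivative (\<lambda>h. iter_deriv f [t *\<^sub>R h] (t *\<^sub>R x))) (at x)"
    using assms by simp
  moreover have "((\<lambda>y. t * f y) has_derivative (\<lambda>h. t * iter_deriv f [h] x)) (at x)"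
    by (intro has_derivative_mult_right D \<open>x \<noteq> 0\<close>)
  ultimately have "iter_deriv f [t *\<^sub>R \<tau>] (t *\<^sub>R x) = t * iter_deriv f [\<tau>] x"
    using has_derivative_unique by metis
  moreover have "linear (\<lambda>v. iter_deriv f [v] (t *\<^sub>R x))"
    using D[of "t *\<^sub>R x"] assms has_derivative_linear by auto
  ultimately show ?thesis
    using linear_scale[of "\<lambda>v. iter_deriv f [v] (t *\<^sub>R x)" t \<tau>] \<open>0 < t\<close> by simp
qed

text \<open>The gradient is constant along rays, so its derivative in the radial direction vanishes.
  This lets traces over the tangent plane be evaluated on vectors that are not tangent.\<close>

lemma hessian_radial:
  fixes f :: "'a::euclidean_space \<Rightarrow> real"
  assumes C: "Ck_on 2 f (- {0})" and hom: "\<And>t z. 0 \<le> t \<Longrightarrow> f (t *\<^sub>R z) = t * f z"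
    and x: "x \<noteq> 0"
  shows "iter_deriv f [x, \<tau>] x = 0"
proof -
  have "Ck_on 1 f (- {0})" using Ck_on_mono[OF C] by simp
  note grad = gradient_homogeneous[OF this hom]
  have "((\<lambda>t. x + t *\<^sub>R x) has_derivative (\<lambda>h. h *\<^sub>R x)) (at 0)"
    by (auto intro!: derivative_eq_intros)
  moreover have "(iter_deriv f [\<tau>] has_derivative (\<lambda>v. iter_deriv f [v, \<tau>] x)) (at (x + 0 *\<^sub>R x))"
    using Ck_on_has_derivative[OF C, of x "[\<tau>]"] x by (simp add: open_Compl)
  ultimately have "((\<lambda>t. iter_deriv f [\<tau>] (x + t *\<^sub>R x)) has_derivative (\<lambda>h. iter_deriv f [h *\<^sub>R x, \<tau>] x)) (at (0::real))"
    by (rule has_derivative_compose)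
  moreover have "((\<lambda>t. iter_deriv f [\<tau>] (x + t *\<^sub>R x)) has_derivative (\<lambda>h. 0)) (at (0::real))"
  proof (rule has_derivative_transform_within_open[OF has_derivative_const])
    show "open {-1<..<1::real}" "0 \<in> {-1<..<1::real}" by auto
    fix t :: real assume "t \<in> {-1<..<1}"
    then show "iter_deriv f [\<tau>] x = iter_deriv f [\<tau>] (x + t *\<^sub>R x)"
      using grad[of "1 + t" x \<tau>] x by (simp add: algebra_simps)
  qed
  ultimately have "(\<lambda>h::real. iter_deriv f [h *\<^sub>R x, \<tau>] x) = (\<lambda>h. 0)"
    by (rule has_derivative_unique)
  from fun_cong[OF this, of 1] show ?thesis by simp
qed

text \<open>The chain rule for y \<mapsto> - y. In \<open>hessian_even\<close> it is used twice:
  with s = 1 for the even function, then with s = - 1 for its odd gradient.\<close>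

lemma derivative_reflect:
  fixes f :: "'a::real_normed_vector \<Rightarrow> real"
  assumes D: "(f has_derivative D) (at x)" and D': "(f has_derivative D') (at (- x))"
    and S: "open S" "x \<in> S" "\<And>y. y \<in> S \<Longrightarrow> f (- y) = s * f y"
  shows "D' v = - s * D v"
proof -
  have "((\<lambda>y. - y) has_derivative (\<lambda>h. - h)) (at x)"
    by (auto intro!: derivative_eq_intros)
  from has_derivative_compose[OF this D']
  have "((\<lambda>y. s * f y) has_derivative (\<lambda>h. D' (- h))) (at x)"
    by (rule has_derivative_transform_within_open[OF _ S])
  moreover have "((\<lambda>y. s * f y) has_derivative (\<lambda>h. s * D h)) (at x)"
    by (intro has_derivative_mult_right D)
  ultimately have "D' (- v) = s * D v"
    using has_derivative_unique by metis
  moreover have "linear D'" using D' has_derivative_linear by blast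
  ultimately show ?thesis by (simp add: linear_neg)
qed

lemma hessian_even:
  fixes f :: "'a::euclidean_space \<Rightarrow> real"
  assumes C: "Ck_on 2 f (- {0})" and even: "\<And>z. f (- z) = f z" and x: "x \<noteq> 0"
  shows "iter_deriv f [\<sigma>, \<tau>] (- x) = iter_deriv f [\<sigma>, \<tau>] x"
proof -
  have op: "open (- {0::'a})" by (simp add: open_Compl)
  have D: "(iter_deriv f vs has_derivative (\<lambda>v. iter_deriv f (v # vs) y)) (at y)"
    if "y \<noteq> 0" "length vs < 2" for y vs
    using Ck_on_has_derivative[OF C op, of y vs] that by simp
  have odd: "iter_deriv f [\<tau>] (- y) = - 1 * iter_deriv f [\<tau>] y" if "y \<in> - {0}" for y
    using derivative_reflect[of f "\<lambda>v. iter_deriv f [v] y" y "\<lambda>v. iter_deriv f [v] (- y)" "- {0}" 1 \<tau>]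
      D[of y "[]"] D[of "- y" "[]"] even op that by simp
  have "iter_deriv f [\<sigma>, \<tau>] (- x) = - (- 1) * iter_deriv f [\<sigma>, \<tau>] x"
    by (rule derivative_reflect[OF D D op _ odd]) (use x in auto)
  then show ?thesis by simp
qed

text \<open>A Lipschitz bound centred at the single point \<open>x\<close>. It will be applied to
  the second derivatives of \<Phi>, which are differentiable because \<Phi> is of class C^3.\<close>

lemma has_derivative_locally_bounded:
  assumes "(f has_derivative D) (at x)"
  obtains K d where "0 < d" "0 < K" "\<And>y. norm (y - x) < d \<Longrightarrow> norm (f y - f x) \<le> K * norm (y - x)"
proof -
  obtain d where d: "0 < d" "\<And>y. norm (y - x) < d \<Longrightarrow> norm (f y - f x - D (y - x)) \<le> 1 * norm (y - x)"
    using assms[unfolded has_derivative_at_alt, THEN conjunct2, rule_format, of 1] by auto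
  have "bounded_linear D" using assms has_derivative_bounded_linear by blast
  then obtain B where B: "0 < B" "\<And>v. norm (D v) \<le> norm v * B"
    using bounded_linear.pos_bounded by blast
  show thesis
  proof (rule that[OF d(1), of "B + 1"])
    fix y assume "norm (y - x) < d"
    then have "norm (f y - f x) \<le> norm (y - x) + norm (y - x) * B"
      using d(2)[of y] B(2)[of "y - x"] norm_triangle_sub[of "f y - f x" "D (y - x)"] by simp
    then show "norm (f y - f x) \<le> (B + 1) * norm (y - x)" by (simp add: algebra_simps)
  qed (use B in simp)
qed

section \<open>Traces over the tangent plane\<close>

lemma orthonormal_basis_finite:
  fixes B :: "'a::euclidean_space set"
  assumes "orthonormal_basis B T"
  shows "finite B" "card B = dim T"
proof -
  have "0 \<notin> B" using assms by (auto simp: orthonormal_basis_def)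
  then have "independent B"
    using assms pairwise_orthogonal_independent by (auto simp: orthonormal_basis_def)
  then show "finite B" "card B = dim T"
    using assms dim_span[of B] dim_eq_card_independent[of B] independent_imp_finite[of B]
    unfolding orthonormal_basis_def by simp_all
qed

text \<open>As \<open>n\<close> lies in the kernel of \<open>A\<close> in both slots,
  \<open>a\<close> and \<open>b\<close> may be replaced by their projections to the hyperplane and
  expanded in \<open>B\<close>. Traces in an arbitrary basis thereby become values of
  \<open>A\<close> on fixed vectors.\<close>

lemma trace_over_hyperplane:
  fixes A :: "'a::euclidean_space \<Rightarrow> 'a \<Rightarrow> real"
  assumes A: "bilinear A" and B: "orthonormal_basis B {v. n \<bullet> v = 0}" and n: "norm n = 1"
    and kernel: "\<And>y. A n y = 0" "\<And>y. A y n = 0"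
  shows "(\<Sum>\<sigma>\<in>B. \<Sum>\<tau>\<in>B. A \<sigma> \<tau> * ((a \<bullet> \<sigma>) * (b \<bullet> \<tau>))) = A a b"
proof -
  note fin = orthonormal_basis_finite(1)[OF B]
  have nB: "n \<bullet> \<sigma> = 0" if "\<sigma> \<in> B" for \<sigma>
    using B that span_base[of \<sigma> B] by (auto simp: orthonormal_basis_def)
  define P where "P x = x - (n \<bullet> x) *\<^sub>R n" for x
  have expand: "(\<Sum>\<sigma>\<in>B. (x \<bullet> \<sigma>) *\<^sub>R \<sigma>) = P x" for x
  proof -
    have "P x \<in> span B"
      using B n by (simp add: orthonormal_basis_def P_def inner_diff_right norm_eq_1)
    then have "(\<Sum>\<sigma>\<in>B. (P x \<bullet> \<sigma>) *\<^sub>R \<sigma>) = P x"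
      using B fin by (intro orthonormal_basis_expand) (auto simp: orthonormal_basis_def)
    moreover have "P x \<bullet> \<sigma> = x \<bullet> \<sigma>" if "\<sigma> \<in> B" for \<sigma>
      using nB[OF that] by (simp add: P_def inner_diff_left)
    ultimately show ?thesis by simp
  qed
  have l: "linear (A x)" "linear (\<lambda>x. A x y)" for x y
    using A by (auto simp: bilinear_def)
  have "A a b = A (P a) (P b)"
    using kernel A by (simp add: P_def bilinear_lsub bilinear_rsub bilinear_lmul bilinear_rmul)
  also have "\<dots> = (\<Sum>\<sigma>\<in>B. (a \<bullet> \<sigma>) * A \<sigma> (P b))"
    by (subst expand[of a, symmetric]) (simp add: linear_sum[OF l(2)] linear_scale[OF l(2)])
  also have "\<dots> = (\<Sum>\<sigma>\<in>B. (a \<bullet> \<sigma>) * (\<Sum>\<tau>\<in>B. (b \<bullet> \<tau>) * A \<sigma> \<tau>))"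
    by (subst expand[of b, symmetric]) (simp add: linear_sum[OF l(1)] linear_scale[OF l(1)])
  finally show ?thesis
    by (simp add: sum_distrib_left mult_ac)
qed

lemma admissibleD:
  fixes \<Phi> :: "'a::euclidean_space \<Rightarrow> real"
  assumes "admissible_integrand \<Phi>"
  shows "Ck_on 3 \<Phi> (- {0})" "Ck_on 2 \<Phi> (- {0})"
    and "\<And>t z. 0 \<le> t \<Longrightarrow> \<Phi> (t *\<^sub>R z) = t * \<Phi> z"
    and "\<And>n \<tau>. norm n = 1 \<Longrightarrow> n \<bullet> \<tau> = 0 \<Longrightarrow> \<tau> \<noteq> 0 \<Longrightarrow> 0 < iter_deriv \<Phi> [\<tau>, \<tau>] n"
proof -
  show C: "Ck_on 3 \<Phi> (- {0})" and "\<And>t z. 0 \<le> t \<Longrightarrow> \<Phi> (t *\<^sub>R z) = t * \<Phi> z"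
    using assms by (auto simp: admissible_integrand_def)
  show "Ck_on 2 \<Phi> (- {0})"
    using Ck_on_mono[OF C] by simp
  fix n \<tau> :: 'a assume n: "norm n = 1" "n \<bullet> \<tau> = 0" "\<tau> \<noteq> 0"
  obtain c where c: "0 < c" "c * (norm \<tau>)\<^sup>2 \<le> iter_deriv \<Phi> [\<tau>, \<tau>] n"
    using assms n by (auto simp: admissible_integrand_def inner_commute)
  have "0 < c * (norm \<tau>)\<^sup>2" using c n by simp
  with c show "0 < iter_deriv \<Phi> [\<tau>, \<tau>] n" by simp
qed

context surface_chart
begin

text \<open>On the tangent plane, \<open>?M\<close> is the Hessian of \<open>F\<close> along
  \<Sigma>, nonnegative at a minimum. Pairing it with the positive form D^2 \<Phi> gives a
  nonnegative trace, and the curvature part of that trace vanishes by the equation.\<close>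

lemma touching_trace:
  assumes adm: "admissible_integrand \<Phi>" and zero: "aniso_trace \<Phi> \<Sigma> \<nu> (\<phi> u) = 0"
    and u: "u \<in> V" and W: "open W" "\<phi> u \<in> W"
    and F: "\<And>x. x \<in> W \<Longrightarrow> (F has_derivative (\<lambda>h. \<xi> x \<bullet> h)) (at x)"
    and H: "(\<xi> has_derivative H) (at (\<phi> u))"
    and min: "\<And>x. x \<in> \<Sigma> \<Longrightarrow> x \<in> W \<Longrightarrow> F (\<phi> u) \<le> F x"
  obtains B where "orthonormal_basis B {v. \<nu> (\<phi> u) \<bullet> v = 0}"
    "0 \<le> (\<Sum>\<sigma>\<in>B. \<Sum>\<tau>\<in>B. iter_deriv \<Phi> [\<sigma>, \<tau>] (\<nu> (\<phi> u)) * (H \<sigma> \<bullet> \<tau>))"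
proof -
  let ?p = "\<phi> u"
  let ?T = "tangent_space \<Sigma> ?p" and ?II = "second_fundamental_form \<Sigma> \<nu> ?p"
  let ?s = "\<xi> ?p \<bullet> \<nu> ?p"
  let ?A = "\<lambda>\<sigma> \<tau>. iter_deriv \<Phi> [\<sigma>, \<tau>] (\<nu> ?p)" and ?M = "\<lambda>\<sigma> \<tau>. H \<sigma> \<bullet> \<tau> + ?s * ?II \<sigma> \<tau>"
  \<comment> \<open>The very basis chosen inside \<open>aniso_trace\<close>, so that the equation
    can be inserted without a change of basis.\<close>
  define B where "B = (SOME B. orthonormal_basis B ?T)"
  note T = tangent_space_normal[OF u] and nn = norm_normal[OF u]
  have "subspace ?T" by (simp add: T subspace_hyperplane)
  then have "\<exists>B. orthonormal_basis B ?T"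
    by (rule orthonormal_basis_subspace) (auto simp: orthonormal_basis_def)
  then have B: "orthonormal_basis B ?T"
    unfolding B_def by (rule someI_ex)
  have nz: "\<nu> ?p \<in> - {0}" using nn by auto
  then have "dim ?T = 2" by (simp add: T dim_hyperplane)
  then have "card B = 2"
    using orthonormal_basis_finite(2)[OF B] by simp
  note C = admissibleD(2)[OF adm]
  have lin: "linear (frechet_derivative \<nu> (at ?p within \<Sigma>))"
    using normal_differentiable[OF u] has_derivative_linear by blast
  have linH: "linear H" using H has_derivative_linear by blast
  have spB: "span B = ?T" using B by (simp add: orthonormal_basis_def)
  have "0 \<le> (\<Sum>\<sigma>\<in>B. \<Sum>\<tau>\<in>B. ?A \<sigma> \<tau> * ?M \<sigma> \<tau>)"
  proof (rule trace_product_nonneg)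
    show bil: "bilinear ?A" by (rule bilinear_iter_deriv[OF C _ nz]) (simp add: open_Compl)
    show "?A x y = ?A y x" for x y by (rule iter_deriv_commute[OF C _ nz]) (simp add: open_Compl)
    show "bilinear ?M"
      unfolding bilinear_def second_fundamental_form_def
      by (intro conjI allI linearI)
        (simp_all add: linear_add[OF lin] linear_add[OF linH] linear_scale[OF lin] linear_scale[OF linH]
          inner_add_left inner_add_right algebra_simps)
    show "card B = 2" by fact
    have Apos: "0 < ?A x x" if "x \<in> span B" "x \<noteq> 0" for x
      by (rule admissibleD(4)[OF adm nn]) (use that spB T in auto)
    show "0 < ?A x x" if "x \<in> B" for x
    proof (rule Apos)
      show "x \<noteq> 0" using B that by (auto simp: orthonormal_basis_def)
    qed (rule span_base[OF that])
    show "0 \<le> ?A x x" if "x \<in> span B" for x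
    proof (cases "x = 0")
      case True
      then show ?thesis using bilinear_lzero[OF bil] by simp
    qed (use Apos that in \<open>simp add: less_imp_le\<close>)
    show "0 \<le> ?M x x" if "x \<in> span B" for x
      by (rule touching_second_order(2)[OF u W F H min]) (use that spB in auto)
  qed
  also have "\<dots> = (\<Sum>\<sigma>\<in>B. \<Sum>\<tau>\<in>B. ?A \<sigma> \<tau> * (H \<sigma> \<bullet> \<tau>) + ?s * (?A \<sigma> \<tau> * ?II \<sigma> \<tau>))"
    by (simp add: distrib_left mult.left_commute)
  also have "\<dots> = (\<Sum>\<sigma>\<in>B. \<Sum>\<tau>\<in>B. ?A \<sigma> \<tau> * (H \<sigma> \<bullet> \<tau>)) + ?s * (\<Sum>\<sigma>\<in>B. \<Sum>\<tau>\<in>B. ?A \<sigma> \<tau> * ?II \<sigma> \<tau>)"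
    by (simp only: sum.distrib sum_distrib_left)
  also have "(\<Sum>\<sigma>\<in>B. \<Sum>\<tau>\<in>B. ?A \<sigma> \<tau> * ?II \<sigma> \<tau>) = 0"
    using zero unfolding aniso_trace_def B_def Let_def .
  finally show thesis
    using that[of B] B T by simp
qed

end

text \<open>The second derivative of \<open>F\<close> is assumed to be a combination of products of
  \<open>h1\<close> and \<open>h2\<close>, as for a linear function plus a function of h1 \<bullet>
  x and h2 \<bullet> x. This removes both the basis and \<nu> from the conclusion, which involves
  only the direction of the gradient.\<close>

lemma touching_principle:
  assumes adm: "admissible_integrand \<Phi>" and even: "\<forall>z. \<Phi> (- z) = \<Phi> z"
    and surf: "smooth_surface \<Sigma>" and normal: "unit_normal \<Sigma> \<nu>"
    and zero: "\<forall>x\<in>\<Sigma>. aniso_trace \<Phi> \<Sigma> \<nu> x = 0"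
    and p: "p \<in> \<Sigma>" and W: "open W" "p \<in> W"
    and F: "\<And>x. x \<in> W \<Longrightarrow> (F has_derivative (\<lambda>h. \<xi> x \<bullet> h)) (at x)"
    and H: "(\<xi> has_derivative (\<lambda>v. (a * (h1 \<bullet> v) + b * (h2 \<bullet> v)) *\<^sub>R h1 + (b * (h1 \<bullet> v) + d * (h2 \<bullet> v)) *\<^sub>R h2)) (at p)"
    and min: "\<And>x. x \<in> \<Sigma> \<Longrightarrow> x \<in> W \<Longrightarrow> F p \<le> F x"
    and nz: "\<xi> p \<noteq> 0"
  shows "0 \<le> a * iter_deriv \<Phi> [h1, h1] (sgn (\<xi> p)) + 2 * b * iter_deriv \<Phi> [h1, h2] (sgn (\<xi> p))
    + d * iter_deriv \<Phi> [h2, h2] (sgn (\<xi> p))"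
proof -
  obtain U and V :: "(real^2) set" and \<phi> \<psi> where *: "open U \<and> p \<in> U \<and> open V \<and>
      homeomorphism V (\<Sigma> \<inter> U) \<phi> \<psi> \<and> smooth_on \<phi> V \<and> (\<forall>u\<in>V. inj (frechet_derivative \<phi> (at u)))"
    using surf[unfolded smooth_surface_def, THEN bspec, OF p] by (elim exE) (rule that, assumption)
  interpret surface_chart \<Sigma> \<nu> U V \<phi> \<psi>
    by unfold_locales (simp_all add: * normal)
  define u where "u = \<psi> p"
  have u: "u \<in> V" and pu: "p = \<phi> u"
    using homeo p * by (auto simp: homeomorphism_def u_def)
  let ?n = "\<nu> (\<phi> u)" and ?A = "\<lambda>\<sigma> \<tau>. iter_deriv \<Phi> [\<sigma>, \<tau>] (\<nu> (\<phi> u))"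
  let ?H = "\<lambda>v. (a * (h1 \<bullet> v) + b * (h2 \<bullet> v)) *\<^sub>R h1 + (b * (h1 \<bullet> v) + d * (h2 \<bullet> v)) *\<^sub>R h2"
  have z: "aniso_trace \<Phi> \<Sigma> \<nu> (\<phi> u) = 0" using zero p pu by simp
  have W': "\<phi> u \<in> W" and H': "(\<xi> has_derivative ?H) (at (\<phi> u))"
    and min': "\<And>x. x \<in> \<Sigma> \<Longrightarrow> x \<in> W \<Longrightarrow> F (\<phi> u) \<le> F x"
    using W H min pu by auto
  obtain B where B: "orthonormal_basis B {v. ?n \<bullet> v = 0}"
    "0 \<le> (\<Sum>\<sigma>\<in>B. \<Sum>\<tau>\<in>B. ?A \<sigma> \<tau> * (?H \<sigma> \<bullet> \<tau>))"
    by (rule touching_trace[OF adm z u W(1) W' F H' min'])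
  note nn = norm_normal[OF u] and C = admissibleD(2)[OF adm]
  have n0: "?n \<in> - {0}" using nn by auto
  have bil: "bilinear ?A" by (rule bilinear_iter_deriv[OF C _ n0]) (simp add: open_Compl)
  have sym: "?A x y = ?A y x" for x y
    by (rule iter_deriv_commute[OF C _ n0]) (simp add: open_Compl)
  have ker: "?A ?n y = 0" for y
    using hessian_radial[OF C admissibleD(3)[OF adm]] n0 by simp
  have ker': "?A y ?n = 0" for y
    using sym[of y ?n] ker[of y] by (rule trans)
  have tr: "(\<Sum>\<sigma>\<in>B. \<Sum>\<tau>\<in>B. ?A \<sigma> \<tau> * ((x \<bullet> \<sigma>) * (y \<bullet> \<tau>))) = ?A x y" for x y
    by (rule trace_over_hyperplane[OF bil B(1) nn]) (fact ker ker')+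
  have "(\<Sum>\<sigma>\<in>B. \<Sum>\<tau>\<in>B. ?A \<sigma> \<tau> * (?H \<sigma> \<bullet> \<tau>)) =
     (\<Sum>\<sigma>\<in>B. \<Sum>\<tau>\<in>B. a * (?A \<sigma> \<tau> * ((h1 \<bullet> \<sigma>) * (h1 \<bullet> \<tau>))) + b * (?A \<sigma> \<tau> * ((h2 \<bullet> \<sigma>) * (h1 \<bullet> \<tau>)))
       + b * (?A \<sigma> \<tau> * ((h1 \<bullet> \<sigma>) * (h2 \<bullet> \<tau>))) + d * (?A \<sigma> \<tau> * ((h2 \<bullet> \<sigma>) * (h2 \<bullet> \<tau>))))"
    by (intro sum.cong refl) (simp add: inner_add_left algebra_simps)
  also have "\<dots> = a * ?A h1 h1 + b * ?A h2 h1 + b * ?A h1 h2 + d * ?A h2 h2"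
    by (simp only: sum.distrib sum_distrib_left[symmetric] tr)
  also have "\<dots> = a * ?A h1 h1 + 2 * b * ?A h1 h2 + d * ?A h2 h2"
    unfolding sym[of h2 h1] by simp
  finally have pos: "0 \<le> a * ?A h1 h1 + 2 * b * ?A h1 h2 + d * ?A h2 h2"
    using B(2) by (rule ord_le_eq_trans[rotated])
  \<comment> \<open>The gradient being normal does not involve the tangent vector \<open>X\<close>,
    so X = 0 is inserted.\<close>
  have "subspace {v. ?n \<bullet> v = 0}" by (simp add: subspace_hyperplane)
  then have "0 \<in> tangent_space \<Sigma> (\<phi> u)" by (simp add: tangent_space_normal[OF u])
  from touching_second_order(1)[OF u W(1) W' F H' min' this]
  have xi: "\<xi> p = (\<xi> p \<bullet> ?n) *\<^sub>R ?n" by (simp add: pu)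
  \<comment> \<open>The normalized gradient is plus or minus the normal, and evenness of \<Phi>
    makes the Hessians at the two agree.\<close>
  have "sgn (\<xi> p) = sgn (\<xi> p \<bullet> ?n) *\<^sub>R ?n"
    by (subst xi) (simp add: sgn_scaleR sgn_div_norm nn)
  moreover have "\<xi> p \<bullet> ?n \<noteq> 0" using nz xi by auto
  ultimately have "sgn (\<xi> p) = ?n \<or> sgn (\<xi> p) = - ?n"
    by (auto simp: sgn_if split: if_splits)
  then have "iter_deriv \<Phi> [x, y] (sgn (\<xi> p)) = ?A x y" for x y
    using hessian_even[OF C, of ?n x y] even n0 by auto
  then show ?thesis using pos by simp
qed

section \<open>Frames conjugate with respect to the Hessian\<close>

text \<open>Gram-Schmidt with respect to \<open>A\<close>, started from a Euclidean orthonormal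
  basis of the plane orthogonal to \<open>e\<close>. The last conclusion says that the frame and
  \<open>e\<close> span the space.\<close>

lemma conjugate_frame:
  fixes A :: "real^3 \<Rightarrow> real^3 \<Rightarrow> real"
  assumes A: "bilinear A" and sym: "\<And>x y. A x y = A y x"
    and pos: "\<And>\<tau>. e \<bullet> \<tau> = 0 \<Longrightarrow> \<tau> \<noteq> 0 \<Longrightarrow> 0 < A \<tau> \<tau>" and e: "e \<noteq> 0"
  obtains g1 g2 where "e \<bullet> g1 = 0" "e \<bullet> g2 = 0" "A g1 g1 = 1" "A g2 g2 = 1" "A g1 g2 = 0"
    "\<And>y. e \<bullet> y = 0 \<Longrightarrow> g1 \<bullet> y = 0 \<Longrightarrow> g2 \<bullet> y = 0 \<Longrightarrow> y = 0"
proof -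
  obtain B where B: "B \<subseteq> {v. e \<bullet> v = 0}" "pairwise orthogonal B" "\<And>x. x \<in> B \<Longrightarrow> norm x = 1"
    "card B = dim {v. e \<bullet> v = 0}" "span B = {v. e \<bullet> v = 0}"
    using orthonormal_basis_subspace[OF subspace_hyperplane, of e] by metis
  have "card B = 2" using B(4) e by (simp add: dim_hyperplane)
  then obtain f1 f2 where f: "B = {f1, f2}" "f1 \<noteq> f2"
    by (auto simp: card_2_iff)
  have f12: "f1 \<bullet> f2 = 0" "f1 \<bullet> f1 = 1" "f2 \<bullet> f2 = 1" "e \<bullet> f1 = 0" "e \<bullet> f2 = 0"
    using B f by (auto simp: pairwise_def orthogonal_def norm_eq_1)
  define a where "a = A f1 f1"
  define g where "g = f2 - (A f1 f2 / a) *\<^sub>R f1"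
  define b where "b = A g g"
  have "f1 \<noteq> 0" using f12 by auto
  then have a: "0 < a" using pos f12 by (simp add: a_def)
  have "g \<bullet> f2 = 1" using f12 by (simp add: g_def inner_diff_left)
  then have "g \<noteq> 0" by auto
  moreover have eg: "e \<bullet> g = 0" using f12 by (simp add: g_def inner_diff_right)
  ultimately have b: "0 < b" using pos by (simp add: b_def)
  have fg: "A f1 g = 0"
    using a A by (simp add: g_def bilinear_rsub bilinear_rmul a_def)
  have sep: "y = 0" if y: "e \<bullet> y = 0" "f1 \<bullet> y = 0" "g \<bullet> y = 0" for y
  proof -
    have "f2 \<bullet> y = 0" using y by (simp add: g_def inner_diff_left)
    then have "orthogonal y b" if "b \<in> B" for b
      using that y f by (auto simp: orthogonal_def inner_commute)
    then have "orthogonal y y"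
      using B(5) y by (intro orthogonal_to_span[of y B]) auto
    then show ?thesis by (simp add: orthogonal_def)
  qed
  show thesis
  proof (rule that)
    show "A ((1 / sqrt a) *\<^sub>R f1) ((1 / sqrt a) *\<^sub>R f1) = 1"
      using a A by (simp add: bilinear_lmul bilinear_rmul flip: a_def)
    show "A ((1 / sqrt b) *\<^sub>R g) ((1 / sqrt b) *\<^sub>R g) = 1"
      using b A by (simp add: bilinear_lmul bilinear_rmul flip: b_def)
    show "A ((1 / sqrt a) *\<^sub>R f1) ((1 / sqrt b) *\<^sub>R g) = 0"
      using A fg by (simp add: bilinear_lmul bilinear_rmul)
  qed (use a b eg f12 sep in auto)
qed

text \<open>The frame is scaled so that the unit disc of \<open>h1, h2\<close> in the plane orthogonal to \<open>e\<close> is small.\<close>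

lemma scaled_conjugate_frame:
  fixes A :: "real^3 \<Rightarrow> real^3 \<Rightarrow> real"
  assumes A: "bilinear A" and sym: "\<And>x y. A x y = A y x"
    and pos: "\<And>\<tau>. e \<bullet> \<tau> = 0 \<Longrightarrow> \<tau> \<noteq> 0 \<Longrightarrow> 0 < A \<tau> \<tau>" and e: "e \<noteq> 0" and "0 < \<rho>"
  obtains h1 h2 \<kappa> \<beta> where "0 < \<kappa>" "0 < \<beta>" "e \<bullet> h1 = 0" "e \<bullet> h2 = 0" "A h1 h1 = \<kappa>" "A h2 h2 = \<kappa>"
    "A h1 h2 = 0"
    "\<And>y. \<beta> * norm y \<le> \<bar>h1 \<bullet> y\<bar> + \<bar>h2 \<bullet> y\<bar> + \<bar>e \<bullet> y\<bar>"
    "\<And>y. e \<bullet> y = 0 \<Longrightarrow> (h1 \<bullet> y)\<^sup>2 + (h2 \<bullet> y)\<^sup>2 \<le> 1 \<Longrightarrow> norm y < \<rho>"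
proof -
  obtain g1 g2 where g: "e \<bullet> g1 = 0" "e \<bullet> g2 = 0" "A g1 g1 = 1" "A g2 g2 = 1" "A g1 g2 = 0"
    and sep: "\<And>y. e \<bullet> y = 0 \<Longrightarrow> g1 \<bullet> y = 0 \<Longrightarrow> g2 \<bullet> y = 0 \<Longrightarrow> y = 0"
    using conjugate_frame[OF A sym pos e] by metis
  let ?L = "\<lambda>y. (g1 \<bullet> y, g2 \<bullet> y, e \<bullet> y)"
  have lin: "linear ?L"
    by (intro linearI) (simp_all add: inner_add_right)
  have "inj ?L"
    using sep by (auto simp: linear_injective_0[OF lin] zero_prod_def)
  then obtain b where b: "0 < b" "\<And>y. b * norm y \<le> norm (?L y)"
    using linear_inj_bounded_below_pos[OF lin] by blast
  have bound: "b * norm y \<le> \<bar>g1 \<bullet> y\<bar> + \<bar>g2 \<bullet> y\<bar> + \<bar>e \<bullet> y\<bar>" for y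
    using b(2)[of y] norm_Pair_le[of "g1 \<bullet> y" "(g2 \<bullet> y, e \<bullet> y)"] norm_Pair_le[of "g2 \<bullet> y" "e \<bullet> y"] by simp
  \<comment> \<open>On the unit disc t b |y| \<le> 2, while t b \<rho> \<ge> 3, which gives |y| <
    \<rho>. Having t \<ge> 1 keeps the coercivity constant \<open>b\<close> valid after
    scaling.\<close>
  define t where "t = max 1 (3 / (b * \<rho>))"
  have t: "1 \<le> t" "3 \<le> t * b * \<rho>"
    using b \<open>0 < \<rho>\<close> by (auto simp: t_def max_def field_simps)
  show thesis
  proof (rule that)
    show "0 < t\<^sup>2" "0 < b" using t b by auto
    show "A (t *\<^sub>R g1) (t *\<^sub>R g1) = t\<^sup>2" "A (t *\<^sub>R g2) (t *\<^sub>R g2) = t\<^sup>2" "A (t *\<^sub>R g1) (t *\<^sub>R g2) = 0"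
      using g A by (simp_all add: bilinear_lmul bilinear_rmul power2_eq_square)
    show "b * norm y \<le> \<bar>t *\<^sub>R g1 \<bullet> y\<bar> + \<bar>t *\<^sub>R g2 \<bullet> y\<bar> + \<bar>e \<bullet> y\<bar>" for y
    proof -
      have "\<bar>x\<bar> \<le> \<bar>t * x\<bar>" for x
        using mult_right_mono[OF t(1), of "\<bar>x\<bar>"] t by (simp add: abs_mult)
      then show ?thesis using bound[of y] by (smt (verit) inner_scaleR_left)
    qed
    show "norm y < \<rho>" if y: "e \<bullet> y = 0" "(t *\<^sub>R g1 \<bullet> y)\<^sup>2 + (t *\<^sub>R g2 \<bullet> y)\<^sup>2 \<le> 1" for y
    proof -
      have "(t * (g1 \<bullet> y))\<^sup>2 + (t * (g2 \<bullet> y))\<^sup>2 \<le> 1" using y(2) by simp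
      then have "(t * (g1 \<bullet> y))\<^sup>2 \<le> 1" "(t * (g2 \<bullet> y))\<^sup>2 \<le> 1"
        using zero_le_power2[of "t * (g1 \<bullet> y)"] zero_le_power2[of "t * (g2 \<bullet> y)"] by linarith+
      then have "\<bar>t * (g1 \<bullet> y)\<bar> \<le> 1" "\<bar>t * (g2 \<bullet> y)\<bar> \<le> 1"
        by (simp_all only: abs_square_le_1)
      then have "t * (b * norm y) \<le> 2"
        using mult_left_mono[OF bound[of y], of t] t y by (simp add: abs_mult algebra_simps)
      also have "\<dots> < t * b * \<rho>" using t by simp
      finally show ?thesis using t b by (simp add: mult.assoc)
    qed
  qed (use g in auto)
qed

section \<open>The logarithmic barrier\<close>

text \<open>The profile \<open>ln r - r\<^bsup>-1/2\<^esup>\<close> and its derivatives as functions of \<open>s = r\<^sup>2\<close>.\<close>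

definition profile :: "real \<Rightarrow> real" where
  "profile s = ln s / 2 - s powr (-1/4)"

definition profile' :: "real \<Rightarrow> real" where
  "profile' s = 1 / (2 * s) + s powr (-5/4) / 4"

definition profile'' :: "real \<Rightarrow> real" where
  "profile'' s = - 1 / (2 * s\<^sup>2) - 5/16 * s powr (-9/4)"

lemma profile_derivative:
  assumes "0 < s"
  shows "(profile has_real_derivative profile' s) (at s)"
    and "(profile' has_real_derivative profile'' s) (at s)"
  using assms unfolding profile_def profile'_def profile''_def
  by (auto intro!: derivative_eq_intros simp: field_simps power2_eq_square)

text \<open>The profile takes the value - 1 at s = 1, hence the shift by 1. The logarithmic bound
  will make sublevel sets of the barrier bounded.\<close>

lemma profile_at_least_1:
  assumes s: "1 \<le> s"
  shows "ln s / 2 \<le> profile s + 1" "0 \<le> profile s + 1"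
proof -
  have "s powr (-1/4) \<le> s powr 0" by (rule powr_mono) (use s in auto)
  then show "ln s / 2 \<le> profile s + 1" using s by (simp add: profile_def)
  moreover have "0 \<le> ln s" using s by simp
  ultimately show "0 \<le> profile s + 1" by linarith
qed

text \<open>Here w = s^(-1/4) = r^(-1/2); it turns the real powers into rational expressions in w
  and s.\<close>

lemma profile_root:
  assumes s: "1 \<le> s"
  obtains w where "0 < w" "w \<le> 1" "w ^ 4 * s = 1"
    "profile' s = (1/2 + w/4) / s" "profile'' s = - (1/2 + 5/16 * w) / s\<^sup>2"
proof (rule that)
  let ?w = "s powr (-1/4)"
  show "0 < ?w" using s by simp
  have "?w \<le> s powr 0" by (rule powr_mono) (use s in auto)
  then show "?w \<le> 1" using s by simp
  have "?w ^ 4 = s powr (-1)" using s by (simp add: powr_power)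
  then show "?w ^ 4 * s = 1" using s by (simp add: powr_minus)
  have "s powr (-5/4) = s powr (-1/4) * s powr (-1)"
    using powr_add[of s "-1/4" "-1"] by simp
  then show "profile' s = (1/2 + ?w/4) / s"
    using s by (simp add: profile'_def powr_minus field_simps)
  have "s powr (-9/4) = s powr (-1/4) * s powr (-2)"
    using powr_add[of s "-1/4" "-2"] by simp
  moreover have "s powr (-2) = 1 / s\<^sup>2"
    using s by (simp add: powr_minus divide_inverse)
  ultimately show "profile'' s = - (1/2 + 5/16 * ?w) / s\<^sup>2"
    using s by (simp add: profile''_def field_simps)
qed

text \<open>The coefficients of \<open>P11\<close>, \<open>P12\<close>, \<open>P22\<close> form the
  Hessian of the profile in X, Y. The logarithm is harmonic, so its trace - w / (4 s) comes from
  r^(-1/2) alone. The absolute values of the entries add up to at most 19/2 / s, so an error \<eta>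
  in the coefficients costs at most 19/2 \<eta> / s; 38 is 4 times 19/2.\<close>

lemma barrier_trace_negative:
  fixes X Y :: real
  assumes s: "s = X\<^sup>2 + Y\<^sup>2" "1 \<le> s"
    and w: "0 < w" "w \<le> 1" "k1 = (1/2 + w/4) / s" "k2 = - (1/2 + 5/16 * w) / s\<^sup>2"
    and P: "\<bar>P11 - \<kappa>\<bar> \<le> \<eta>" "\<bar>P12\<bar> \<le> \<eta>" "\<bar>P22 - \<kappa>\<bar> \<le> \<eta>" and \<eta>: "38 * \<eta> < \<kappa> * w"
  shows "(4 * k2 * X\<^sup>2 + 2 * k1) * P11 + 2 * (4 * k2 * X * Y) * P12 + (4 * k2 * Y\<^sup>2 + 2 * k1) * P22 < 0"
proof -
  let ?a = "4 * k2 * X\<^sup>2 + 2 * k1" and ?b = "4 * k2 * X * Y" and ?d = "4 * k2 * Y\<^sup>2 + 2 * k1"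
  have "s \<noteq> 0" using s(2) by linarith
  have k2s: "k2 * s = - (1/2 + 5/16 * w) / s"
    using \<open>s \<noteq> 0\<close> by (simp add: w power2_eq_square)
  have tr: "?a + ?d = - w / (4 * s)"
  proof -
    have "?a + ?d = 4 * (k2 * s) + 4 * k1" by (simp add: s algebra_simps)
    also have "\<dots> = - w / (4 * s)"
      unfolding k2s w(3) using \<open>s \<noteq> 0\<close> by (simp add: field_simps)
    finally show ?thesis .
  qed
  have k1: "0 \<le> k1" "k1 \<le> 3/4 / s"
    using w(1,2) s(2) unfolding w(3) by (simp, intro divide_right_mono) simp_all
  have k2: "k2 \<le> 0" unfolding w(4) using w(1) by (intro divide_nonpos_nonneg) auto
  have "0 \<le> \<eta>" using P(2) by linarith
  have "2 * \<bar>X * Y\<bar> \<le> s"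
    using sum_squares_bound[of "\<bar>X\<bar>" "\<bar>Y\<bar>"] by (simp add: s abs_mult)
  then have b: "2 * \<bar>?b\<bar> \<le> 4 * (- k2 * s)"
    using mult_left_mono[of "2 * \<bar>X * Y\<bar>" s "- k2"] k2 by (simp add: abs_mult)
  have "\<bar>?a\<bar> \<le> 4 * (- k2) * X\<^sup>2 + 2 * k1" "\<bar>?d\<bar> \<le> 4 * (- k2) * Y\<^sup>2 + 2 * k1"
    using k1 k2 mult_nonneg_nonneg[of "- k2" "X\<^sup>2"] mult_nonneg_nonneg[of "- k2" "Y\<^sup>2"] by (auto simp: abs_le_iff)
  then have "\<bar>?a\<bar> + 2 * \<bar>?b\<bar> + \<bar>?d\<bar> \<le> 8 * (- k2 * s) + 4 * k1"
    using b by (simp add: s algebra_simps)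
  also have "\<dots> \<le> 8 * ((13/16) / s) + 4 * (3/4 / s)"
  proof -
    have "- k2 * s = (1/2 + 5/16 * w) / s"
      unfolding mult_minus_left k2s by (simp only: minus_divide_left minus_minus)
    also have "\<dots> \<le> (13/16) / s" using w(2) s(2) by (intro divide_right_mono) simp_all
    finally show ?thesis using k1(2) by (intro add_mono mult_left_mono) simp_all
  qed
  also have "\<dots> = 19/2 / s" by (simp add: field_simps)
  finally have sum: "\<bar>?a\<bar> + 2 * \<bar>?b\<bar> + \<bar>?d\<bar> \<le> 19/2 / s" .
  have "?a * P11 + 2 * ?b * P12 + ?d * P22 = \<kappa> * (?a + ?d) + ?a * (P11 - \<kappa>) + 2 * ?b * P12 + ?d * (P22 - \<kappa>)"
    by (simp add: algebra_simps)
  also have "\<dots> \<le> \<kappa> * (?a + ?d) + \<bar>?a\<bar> * \<eta> + 2 * \<bar>?b\<bar> * \<eta> + \<bar>?d\<bar> * \<eta>"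
  proof -
    have est: "x * y \<le> \<bar>x\<bar> * \<eta>" if "\<bar>y\<bar> \<le> \<eta>" for x y
      using mult_left_mono[OF that, of "\<bar>x\<bar>"] abs_ge_self[of "x * y"] by (simp add: abs_mult)
    show ?thesis
      using est[OF P(1), of ?a] est[OF P(2), of "2 * ?b"] est[OF P(3), of ?d] by (simp add: abs_mult)
  qed
  also have "\<dots> = \<kappa> * (?a + ?d) + (\<bar>?a\<bar> + 2 * \<bar>?b\<bar> + \<bar>?d\<bar>) * \<eta>"
    by (simp add: algebra_simps)
  also have "\<dots> \<le> \<kappa> * (- w / (4 * s)) + 19/2 / s * \<eta>"
    unfolding tr using mult_right_mono[OF sum \<open>0 \<le> \<eta>\<close>] by simp
  also have "\<dots> = (38 * \<eta> - \<kappa> * w) / (4 * s)"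
    using \<open>s \<noteq> 0\<close> by (simp add: field_simps)
  also have "\<dots> < 0"
    using \<eta> s by (intro divide_neg_pos) auto
  finally show ?thesis .
qed

text \<open>Normalizing moves \<open>x\<close> by | |x| - 1 |, which is at most |x - e|.\<close>

lemma norm_sgn_diff_le:
  fixes x e :: "'a::real_inner"
  assumes "norm e = 1" "1 \<le> norm x"
  shows "norm (sgn x - e) \<le> 2 * norm (x - e)"
proof -
  have "sgn x - x = (1 / norm x - 1) *\<^sub>R x" by (simp add: sgn_div_norm divide_inverse algebra_simps)
  then have "norm (sgn x - x) = \<bar>(1 / norm x - 1) * norm x\<bar>" by (simp add: abs_mult)
  also have "(1 / norm x - 1) * norm x = 1 - norm x"
  proof -
    have "norm x \<noteq> 0" using assms(2) by linarith
    then show ?thesis by (simp add: left_diff_distrib)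
  qed
  finally have "norm (sgn x - x) = \<bar>norm x - norm e\<bar>"
    using assms by simp
  also have "\<dots> \<le> norm (x - e)" by (rule norm_triangle_ineq3)
  finally show ?thesis
    using norm_triangle_ineq[of "sgn x - x" "x - e"] by simp
qed

section \<open>The halfspace theorem\<close>

lemma proper_imp_closed:
  assumes "proper_in_space \<Sigma>"
  shows "closed \<Sigma>"
proof -
  have "x \<in> \<Sigma>" if "x islimpt \<Sigma>" for x
  proof -
    have "closed (\<Sigma> \<inter> cball x 1)"
      using assms by (simp add: proper_in_space_def compact_imp_closed)
    moreover have "x islimpt (\<Sigma> \<inter> cball x 1)"
      using that unfolding islimpt_approachable
      by (metis IntI dist_commute less_eq_real_def mem_cball min_less_iff_conj zero_less_one)
    ultimately show ?thesis by (simp add: closed_limpt)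
  qed
  then show ?thesis by (simp add: closed_limpt)
qed

text \<open>The Hessian is arranged in the form that \<open>touching_principle\<close> expects; the
  factors 4 and 2 come from the chain rule for s = X^2 + Y^2.\<close>

lemma barrier_derivatives:
  fixes h1 h2 e c :: "'a::real_inner" and \<epsilon> :: real
  defines "X \<equiv> \<lambda>x. h1 \<bullet> (x - c)" and "Y \<equiv> \<lambda>x. h2 \<bullet> (x - c)"
  defines "q \<equiv> \<lambda>x. (X x)\<^sup>2 + (Y x)\<^sup>2"
  defines "\<xi> \<equiv> \<lambda>x. e + (2 * \<epsilon> * profile' (q x)) *\<^sub>R (X x *\<^sub>R h1 + Y x *\<^sub>R h2)"
  assumes pos: "0 < q x"
  shows "((\<lambda>x. e \<bullet> x + \<epsilon> * profile (q x)) has_derivative (\<lambda>h. \<xi> x \<bullet> h)) (at x)"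
    and "(\<xi> has_derivative (\<lambda>v.
      (\<epsilon> * (4 * profile'' (q x) * (X x)\<^sup>2 + 2 * profile' (q x)) * (h1 \<bullet> v) + \<epsilon> * (4 * profile'' (q x) * X x * Y x) * (h2 \<bullet> v)) *\<^sub>R h1
      + (\<epsilon> * (4 * profile'' (q x) * X x * Y x) * (h1 \<bullet> v) + \<epsilon> * (4 * profile'' (q x) * (Y x)\<^sup>2 + 2 * profile' (q x)) * (h2 \<bullet> v)) *\<^sub>R h2)) (at x)"
proof -
  have X: "(X has_derivative (\<lambda>v. h1 \<bullet> v)) (at x)" and Y: "(Y has_derivative (\<lambda>v. h2 \<bullet> v)) (at x)"
    unfolding X_def Y_def by (auto intro!: derivative_eq_intros)
  have q: "(q has_derivative (\<lambda>v. 2 * X x * (h1 \<bullet> v) + 2 * Y x * (h2 \<bullet> v))) (at x)"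
    unfolding q_def by (auto intro!: derivative_eq_intros X Y)
  have k: "((\<lambda>x. profile (q x)) has_derivative (\<lambda>v. profile' (q x) * (2 * X x * (h1 \<bullet> v) + 2 * Y x * (h2 \<bullet> v)))) (at x)"
    using has_derivative_compose[OF q profile_derivative(1)[OF pos, unfolded has_field_derivative_def]] .
  have k': "((\<lambda>x. profile' (q x)) has_derivative (\<lambda>v. profile'' (q x) * (2 * X x * (h1 \<bullet> v) + 2 * Y x * (h2 \<bullet> v)))) (at x)"
    using has_derivative_compose[OF q profile_derivative(2)[OF pos, unfolded has_field_derivative_def]] .
  show "((\<lambda>x. e \<bullet> x + \<epsilon> * profile (q x)) has_derivative (\<lambda>h. \<xi> x \<bullet> h)) (at x)"
    unfolding \<xi>_def
    by (rule has_derivative_eq_rhs, rule has_derivative_add[OF has_derivative_inner_right[OF has_derivative_ident] has_derivative_mult_right[OF k]])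
      (simp add: fun_eq_iff inner_add_left algebra_simps)
  show "(\<xi> has_derivative (\<lambda>v.
      (\<epsilon> * (4 * profile'' (q x) * (X x)\<^sup>2 + 2 * profile' (q x)) * (h1 \<bullet> v) + \<epsilon> * (4 * profile'' (q x) * X x * Y x) * (h2 \<bullet> v)) *\<^sub>R h1
      + (\<epsilon> * (4 * profile'' (q x) * X x * Y x) * (h1 \<bullet> v) + \<epsilon> * (4 * profile'' (q x) * (Y x)\<^sup>2 + 2 * profile' (q x)) * (h2 \<bullet> v)) *\<^sub>R h2)) (at x)"
    unfolding \<xi>_def
    by (rule has_derivative_eq_rhs, rule has_derivative_add[OF has_derivative_const has_derivative_scaleR[OF has_derivative_mult_right[OF k']
         has_derivative_add[OF has_derivative_scaleR_left[OF X] has_derivative_scaleR_left[OF Y]]]])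
      (simp add: fun_eq_iff scaleR_add_left algebra_simps power2_eq_square)
qed

lemma gap_above_supporting_plane:
  fixes e c :: "real^3"
  assumes adm: "admissible_integrand \<Phi>" and even: "\<forall>z. \<Phi> (- z) = \<Phi> z"
    and surf: "smooth_surface \<Sigma>" and normal: "unit_normal \<Sigma> \<nu>"
    and zero: "\<forall>x\<in>\<Sigma>. aniso_trace \<Phi> \<Sigma> \<nu> x = 0" and closed: "closed \<Sigma>"
    and e: "norm e = 1" and lower: "\<And>x. x \<in> \<Sigma> \<Longrightarrow> m \<le> e \<bullet> x" and c: "e \<bullet> c = m" "c \<notin> \<Sigma>"
  shows "\<exists>\<delta>>0. \<forall>x\<in>\<Sigma>. m + \<delta> \<le> e \<bullet> x"
proof -
  note C = admissibleD(2)[OF adm] and C3 = admissibleD(1)[OF adm]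
  have e0: "e \<in> - {0}" "e \<noteq> 0" and op: "open (- {0 :: real^3})"
    using e by (auto simp: open_Compl)
  let ?A = "\<lambda>x \<sigma> \<tau>. iter_deriv \<Phi> [\<sigma>, \<tau>] x"
  obtain \<rho> where \<rho>: "0 < \<rho>" "ball c \<rho> \<inter> \<Sigma> = {}"
  proof -
    have "open (- \<Sigma>)" "c \<in> - \<Sigma>" using closed c by (auto simp: open_Compl)
    then obtain \<rho> where "0 < \<rho>" "ball c \<rho> \<subseteq> - \<Sigma>" using open_contains_ball by blast
    then show thesis by (intro that[of \<rho>]) auto
  qed
  \<comment> \<open>For this frame the trace of D^2 \<Phi>(e) against the Hessian of a function of
    X, Y is \<kappa> times its Laplacian in these coordinates. The scale \<rho> puts the disc q
    \<le> 1 of the supporting plane inside the ball that misses \<Sigma>.\<close>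
  obtain h1 h2 \<kappa> \<beta> where \<kappa>: "0 < \<kappa>" and \<beta>: "0 < \<beta>" and eh: "e \<bullet> h1 = 0" "e \<bullet> h2 = 0"
    and A: "?A e h1 h1 = \<kappa>" "?A e h2 h2 = \<kappa>" "?A e h1 h2 = 0"
    and coercive: "\<And>y. \<beta> * norm y \<le> \<bar>h1 \<bullet> y\<bar> + \<bar>h2 \<bullet> y\<bar> + \<bar>e \<bullet> y\<bar>"
    and disc: "\<And>y. e \<bullet> y = 0 \<Longrightarrow> (h1 \<bullet> y)\<^sup>2 + (h2 \<bullet> y)\<^sup>2 \<le> 1 \<Longrightarrow> norm y < \<rho>"
    using scaled_conjugate_frame[OF bilinear_iter_deriv[OF C op e0(1)] iter_deriv_commute[OF C op e0(1)]
        admissibleD(4)[OF adm e] e0(2) \<rho>(1)] by metis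
  define X where "X x = h1 \<bullet> (x - c)" for x
  define Y where "Y x = h2 \<bullet> (x - c)" for x
  define q where "q x = (X x)\<^sup>2 + (Y x)\<^sup>2" for x
  have cont_q: "continuous_on S q" for S
    unfolding q_def X_def Y_def by (intro continuous_intros)
  \<comment> \<open>In a slab of bounded height \<open>q\<close> controls the norm; both
    minimizations below get their compactness from this.\<close>
  have bounded: "bounded {x. q x \<le> R \<and> m \<le> e \<bullet> x \<and> e \<bullet> x \<le> m + 1}" for R
  proof (rule boundedI)
    fix x assume "x \<in> {x. q x \<le> R \<and> m \<le> e \<bullet> x \<and> e \<bullet> x \<le> m + 1}"
    then have x: "q x \<le> R" "\<bar>e \<bullet> (x - c)\<bar> \<le> 1" by (auto simp: inner_diff_right c)
    have ab: "\<bar>t\<bar> \<le> t\<^sup>2 + 1" for t :: real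
      using zero_le_power2[of "\<bar>t\<bar> - 1"] by (simp add: power2_diff)
    have "\<bar>X x\<bar> + \<bar>Y x\<bar> \<le> q x + 2"
      using ab[of "X x"] ab[of "Y x"] by (simp add: q_def)
    then have "\<beta> * norm (x - c) \<le> R + 3"
      using coercive[of "x - c"] x by (simp add: X_def Y_def)
    then have "norm (x - c) \<le> (R + 3) / \<beta>"
      using \<beta> by (simp add: field_simps)
    then show "norm x \<le> (R + 3) / \<beta> + norm c"
      using norm_triangle_sub[of x c] by simp
  qed
  \<comment> \<open>The height of \<Sigma> above the disc. The cylinder is cut off at height m + 1
    to be compact; points above the cut satisfy the bound because \<delta> \<le> 1.\<close>
  have "\<exists>\<delta>>0. \<delta> \<le> 1 \<and> (\<forall>x\<in>\<Sigma>. q x \<le> 1 \<longrightarrow> m + \<delta> \<le> e \<bullet> x)"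
  proof -
    define K0 where "K0 = \<Sigma> \<inter> {x. q x \<le> 1 \<and> m \<le> e \<bullet> x \<and> e \<bullet> x \<le> m + 1}"
    have "closed {x. q x \<le> 1 \<and> m \<le> e \<bullet> x \<and> e \<bullet> x \<le> m + 1}"
      by (intro closed_Collect_conj closed_Collect_le continuous_intros cont_q)
    then have "compact K0"
      unfolding K0_def compact_eq_bounded_closed using bounded closed
      by (meson bounded_subset closed_Int inf_le2)
    show ?thesis
    proof (cases "K0 = {}")
      case True
      then show ?thesis using lower by (intro exI[of _ 1]) (force simp: K0_def)
    next
      case False
      have "continuous_on K0 (\<lambda>x. e \<bullet> x)" by (intro continuous_intros)
      then obtain p where p: "p \<in> K0" "\<And>x. x \<in> K0 \<Longrightarrow> e \<bullet> p \<le> e \<bullet> x"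
        using continuous_attains_inf[OF \<open>compact K0\<close> False] by blast
      have "e \<bullet> p \<noteq> m"
      proof
        assume "e \<bullet> p = m"
        then have "norm (p - c) < \<rho>"
          using p(1) by (intro disc) (auto simp: K0_def inner_diff_right c q_def X_def Y_def)
        with \<rho>(2) p(1) show False by (auto simp: K0_def dist_norm norm_minus_commute)
      qed
      moreover have "m \<le> e \<bullet> p" using p(1) lower by (simp add: K0_def)
      moreover have "m + min 1 (e \<bullet> p - m) \<le> e \<bullet> x" if "x \<in> \<Sigma>" "q x \<le> 1" for x
      proof (cases "e \<bullet> x \<le> m + 1")
        case True
        then have "x \<in> K0" using that lower by (simp add: K0_def)
        with p(2) show ?thesis by force
      qed auto
      ultimately show ?thesis by (intro exI[of _ "min 1 (e \<bullet> p - m)"]) auto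
    qed
  qed
  then obtain \<delta> where \<delta>: "0 < \<delta>" "\<delta> \<le> 1" "\<And>x. x \<in> \<Sigma> \<Longrightarrow> q x \<le> 1 \<Longrightarrow> m + \<delta> \<le> e \<bullet> x"
    by blast
  have "m + \<delta> / 2 \<le> e \<bullet> x0" if x0: "x0 \<in> \<Sigma>" for x0
  proof (rule ccontr)
    assume "\<not> m + \<delta> / 2 \<le> e \<bullet> x0"
    then have gap: "0 < m + \<delta> / 2 - e \<bullet> x0" by simp
    have qx0: "1 < q x0" using \<delta>(3)[OF x0] \<delta>(1) gap by (rule_tac ccontr) auto
    \<comment> \<open>A linear bound, rather than mere continuity, is what makes the error from
      tilting the normal quadratic in \<epsilon>.\<close>
    have "\<exists>K d. 0 < d \<and> 0 < K \<and> (\<forall>y. norm (y - e) < d \<longrightarrow> \<bar>?A y \<sigma> \<tau> - ?A e \<sigma> \<tau>\<bar> \<le> K * norm (y - e))" for \<sigma> \<tau>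
    proof -
      obtain K d where "0 < d" "0 < K" "\<And>y. norm (y - e) < d \<Longrightarrow> norm (?A y \<sigma> \<tau> - ?A e \<sigma> \<tau>) \<le> K * norm (y - e)"
        by (rule has_derivative_locally_bounded[OF Ck_on_has_derivative[OF C3 op e0(1), of "[\<sigma>, \<tau>]"]]) auto
      then show ?thesis by auto
    qed
    then obtain K d where Kd: "\<And>\<sigma> \<tau>. 0 < d \<sigma> \<tau>" "\<And>\<sigma> \<tau>. 0 < K \<sigma> \<tau>"
      "\<And>\<sigma> \<tau> y. norm (y - e) < d \<sigma> \<tau> \<Longrightarrow> \<bar>?A y \<sigma> \<tau> - ?A e \<sigma> \<tau>\<bar> \<le> K \<sigma> \<tau> * norm (y - e)"
      by metis
    define L where "L = K h1 h1 + K h1 h2 + K h2 h2"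
    define r where "r = min (d h1 h1) (min (d h1 h2) (d h2 h2))"
    have L: "0 < L" and r: "0 < r" using Kd by (auto simp: L_def r_def intro!: add_pos_pos)
    have Lip: "\<bar>?A y h1 h1 - \<kappa>\<bar> \<le> L * norm (y - e)" "\<bar>?A y h1 h2\<bar> \<le> L * norm (y - e)"
      "\<bar>?A y h2 h2 - \<kappa>\<bar> \<le> L * norm (y - e)" if "norm (y - e) < r" for y
    proof -
      have "K h1 h1 * norm (y - e) \<le> L * norm (y - e)" "K h1 h2 * norm (y - e) \<le> L * norm (y - e)"
        "K h2 h2 * norm (y - e) \<le> L * norm (y - e)"
        using Kd(2)[of h1 h1] Kd(2)[of h1 h2] Kd(2)[of h2 h2] unfolding L_def by (intro mult_right_mono; simp)+
      then show "\<bar>?A y h1 h1 - \<kappa>\<bar> \<le> L * norm (y - e)" "\<bar>?A y h1 h2\<bar> \<le> L * norm (y - e)"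
        "\<bar>?A y h2 h2 - \<kappa>\<bar> \<le> L * norm (y - e)"
        using Kd(3)[of y h1 h1] Kd(3)[of y h1 h2] Kd(3)[of y h2 h2] that A by (auto simp: r_def)
    qed
    define N where "N = norm h1 + norm h2 + 1"
    have N: "0 < N" by (simp add: N_def add_nonneg_pos)
    let ?k0 = "profile (q x0) + 1"
    have k0: "0 \<le> ?k0" using profile_at_least_1(2) qx0 by simp
    \<comment> \<open>The three bounds put \<open>x0\<close> into the sublevel set
      \<open>K1\<close>, keep the tilted normal within the radius \<open>r\<close> of the Lipschitz
      bound, and make the coefficient error smaller than the negative trace. The constants 6 and 200
      exceed the required 3 and 114 to give strict inequalities.\<close>
    define \<epsilon> where "\<epsilon> = min ((m + \<delta> / 2 - e \<bullet> x0) / (?k0 + 1)) (min (r / (6 * N)) (\<kappa> / (200 * L * N)))"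
    have \<epsilon>: "0 < \<epsilon>" using gap k0 r N \<kappa> L by (simp add: \<epsilon>_def)
    have "\<epsilon> * (?k0 + 1) \<le> m + \<delta> / 2 - e \<bullet> x0"
    proof -
      have "\<epsilon> \<le> (m + \<delta> / 2 - e \<bullet> x0) / (?k0 + 1)" by (simp add: \<epsilon>_def)
      then show ?thesis using k0 by (simp add: pos_le_divide_eq)
    qed
    then have \<epsilon>1: "\<epsilon> * ?k0 \<le> m + \<delta> / 2 - e \<bullet> x0"
      using \<epsilon> by (simp add: distrib_left)
    have "\<epsilon> \<le> r / (6 * N)" by (simp add: \<epsilon>_def)
    then have "6 * N * \<epsilon> \<le> r" using N by (simp add: pos_le_divide_eq mult_ac)
    then have \<epsilon>2: "3 * \<epsilon> * N < r" using r by (simp add: mult_ac)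
    have "\<epsilon> \<le> \<kappa> / (200 * L * N)" by (simp add: \<epsilon>_def)
    then have "\<epsilon> * (200 * L * N) \<le> \<kappa>" using N L by (subst (asm) pos_le_divide_eq) auto
    then have \<epsilon>3: "38 * (L * (3 * \<epsilon> * N)) < \<kappa>" using L N \<epsilon> \<kappa> by (simp add: mult_ac)
    define F where "F x = e \<bullet> x + \<epsilon> * profile (q x)" for x
    define S where "S = \<Sigma> \<inter> {x. 1 \<le> q x}"
    \<comment> \<open>On the rim q = 1 the barrier is the height minus \<epsilon>, at least m +
      \<delta> - \<epsilon> > t, so a minimum at level at most \<open>t\<close> avoids the
      rim.\<close>
    define t where "t = m + \<delta> / 2 - \<epsilon>"
    define K1 where "K1 = S \<inter> F -` {..t}"
    have "closed {x. 1 \<le> q x}"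
      by (intro closed_Collect_le continuous_intros cont_q)
    then have "closed S" unfolding S_def using closed by (rule closed_Int[rotated])
    moreover have contF: "continuous_on S F"
      unfolding F_def profile_def by (intro continuous_intros cont_q) (auto simp: S_def)
    ultimately have "closed K1"
      unfolding K1_def by (intro continuous_closed_preimage) auto
    \<comment> \<open>The logarithmic growth of the barrier bounds \<open>q\<close> on the sublevel
      set, although \<Sigma> itself may be unbounded.\<close>
    have "K1 \<subseteq> {x. q x \<le> exp (\<delta> / \<epsilon>) \<and> m \<le> e \<bullet> x \<and> e \<bullet> x \<le> m + 1}"
    proof clarify
      fix x assume "x \<in> K1"
      then have x: "x \<in> \<Sigma>" "1 \<le> q x" "e \<bullet> x + \<epsilon> * (profile (q x) + 1) \<le> m + \<delta> / 2"
        by (auto simp: K1_def S_def F_def t_def algebra_simps)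
      have "0 \<le> \<epsilon> * (profile (q x) + 1)"
        using \<epsilon> profile_at_least_1(2)[OF x(2)] by simp
      then have "e \<bullet> x \<le> m + 1" using x(3) \<delta> by linarith
      have "\<epsilon> * (ln (q x) / 2) \<le> \<epsilon> * (profile (q x) + 1)"
        using \<epsilon> profile_at_least_1(1)[OF x(2)] by simp
      also have "\<dots> \<le> \<delta> / 2" using x(3) lower[OF x(1)] by linarith
      finally have "ln (q x) \<le> \<delta> / \<epsilon>" using \<epsilon> by (simp add: field_simps)
      then have "q x \<le> exp (\<delta> / \<epsilon>)" using x(2)
        using exp_le_cancel_iff[of "ln (q x)" "\<delta> / \<epsilon>"] by simp
      with \<open>e \<bullet> x \<le> m + 1\<close> lower[OF x(1)]
      show "q x \<le> exp (\<delta> / \<epsilon>) \<and> m \<le> e \<bullet> x \<and> e \<bullet> x \<le> m + 1" by simp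
    qed
    then have "compact K1"
      unfolding compact_eq_bounded_closed using \<open>closed K1\<close> bounded_subset[OF bounded] by blast
    moreover have "x0 \<in> K1"
      using x0 qx0 \<epsilon>1 by (simp add: K1_def S_def F_def t_def algebra_simps)
    moreover have "continuous_on K1 F"
      using contF by (rule continuous_on_subset) (simp add: K1_def)
    ultimately obtain p where p: "p \<in> K1" "\<And>x. x \<in> K1 \<Longrightarrow> F p \<le> F x"
      using continuous_attains_inf[of K1 F] by blast
    have p\<Sigma>: "p \<in> \<Sigma>" and Fp: "F p \<le> t" using p(1) by (auto simp: K1_def S_def)
    have qp: "1 < q p"
    proof (rule ccontr)
      assume "\<not> 1 < q p"
      then have "q p = 1" using p(1) by (auto simp: K1_def S_def)
      then have "F p = e \<bullet> p - \<epsilon>" by (simp add: F_def profile_def)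
      with \<delta>(3)[OF p\<Sigma>] \<open>q p = 1\<close> Fp \<delta>(1) show False by (simp add: t_def)
    qed
    define W where "W = {x. 1 < q x}"
    have W: "open W" "p \<in> W"
      using qp unfolding W_def by (auto intro!: open_Collect_less continuous_intros cont_q)
    \<comment> \<open>Outside \<open>K1\<close> the barrier exceeds \<open>t\<close>, so the minimum
      over \<open>K1\<close> is one over all of \<Sigma> \<inter> W.\<close>
    have min: "F p \<le> F x" if "x \<in> \<Sigma>" "x \<in> W" for x
    proof (cases "F x \<le> t")
      case True
      then show ?thesis using that by (intro p(2)) (auto simp: K1_def S_def W_def)
    qed (use Fp in auto)
    define \<xi> where "\<xi> = (\<lambda>x. e + (2 * \<epsilon> * profile' (q x)) *\<^sub>R (X x *\<^sub>R h1 + Y x *\<^sub>R h2))"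
    let ?a = "4 * profile'' (q p) * (X p)\<^sup>2 + 2 * profile' (q p)"
    let ?b = "4 * profile'' (q p) * X p * Y p"
    let ?d = "4 * profile'' (q p) * (Y p)\<^sup>2 + 2 * profile' (q p)"
    let ?n = "sgn (\<xi> p)"
    have der: "(F has_derivative (\<lambda>h. \<xi> x \<bullet> h)) (at x)" if "x \<in> W" for x
      using barrier_derivatives(1)[of h1 x c h2 e \<epsilon>] that
      unfolding F_def \<xi>_def q_def X_def Y_def W_def by simp
    have der2: "(\<xi> has_derivative (\<lambda>v. (\<epsilon> * ?a * (h1 \<bullet> v) + \<epsilon> * ?b * (h2 \<bullet> v)) *\<^sub>R h1
        + (\<epsilon> * ?b * (h1 \<bullet> v) + \<epsilon> * ?d * (h2 \<bullet> v)) *\<^sub>R h2)) (at p)"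
      using barrier_derivatives(2)[of h1 p c h2 e \<epsilon>] qp
      unfolding \<xi>_def q_def X_def Y_def by simp
    \<comment> \<open>The barrier changes the gradient only by vectors orthogonal to
      \<open>e\<close>, so the gradient has norm at least 1.\<close>
    have "e \<bullet> \<xi> p = 1"
      using e eh by (simp add: \<xi>_def inner_add_right norm_eq_1)
    then have xi1: "1 \<le> norm (\<xi> p)"
      using Cauchy_Schwarz_ineq2[of e "\<xi> p"] e by simp
    then have "\<xi> p \<noteq> 0" by auto
    from touching_principle[OF adm even surf normal zero p\<Sigma> W der der2 min this]
    have "0 \<le> \<epsilon> * ?a * ?A ?n h1 h1 + 2 * (\<epsilon> * ?b) * ?A ?n h1 h2 + \<epsilon> * ?d * ?A ?n h2 h2" .
    also have "\<dots> = \<epsilon> * (?a * ?A ?n h1 h1 + 2 * ?b * ?A ?n h1 h2 + ?d * ?A ?n h2 h2)"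
      by (simp add: algebra_simps)
    finally have contra: "0 \<le> ?a * ?A ?n h1 h1 + 2 * ?b * ?A ?n h1 h2 + ?d * ?A ?n h2 h2"
      using \<epsilon> by (simp add: zero_le_mult_iff)
    obtain w where w: "0 < w" "w \<le> 1" "w ^ 4 * q p = 1"
      "profile' (q p) = (1/2 + w/4) / q p" "profile'' (q p) = - (1/2 + 5/16 * w) / (q p)\<^sup>2"
      using profile_root[of "q p"] qp by auto
    \<comment> \<open>With r = sqrt (q p) = 1 / w^2, both |X p| and |Y p| are at most r and the
      derivative of the profile is at most 3/4 w^4, so the tilt is of order \<epsilon> w^2. The
      weaker order \<epsilon> w is enough, since the negative trace carries one factor w.\<close>
    have near: "norm (?n - e) \<le> 3 * \<epsilon> * N * w"
    proof -
      have iq: "1 / q p = w ^ 4" using w(3) qp by (simp add: field_simps)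
      have root: "\<bar>z\<bar> \<le> 1 / w\<^sup>2" if "z\<^sup>2 \<le> q p" for z
      proof (rule power2_le_imp_le)
        have "q p = (1 / w\<^sup>2)\<^sup>2" using w(1,3) by (simp add: field_simps flip: power_mult)
        then show "\<bar>z\<bar>\<^sup>2 \<le> (1 / w\<^sup>2)\<^sup>2" using that by simp
      qed simp
      have "norm (X p *\<^sub>R h1 + Y p *\<^sub>R h2) \<le> \<bar>X p\<bar> * norm h1 + \<bar>Y p\<bar> * norm h2"
        using norm_triangle_ineq[of "X p *\<^sub>R h1" "Y p *\<^sub>R h2"] by simp
      also have "\<dots> \<le> 1 / w\<^sup>2 * norm h1 + 1 / w\<^sup>2 * norm h2"
        by (intro add_mono mult_right_mono root) (auto simp: q_def)
      also have "\<dots> \<le> 1 / w\<^sup>2 * N" by (simp add: N_def distrib_left)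
      finally have 1: "norm (X p *\<^sub>R h1 + Y p *\<^sub>R h2) \<le> 1 / w\<^sup>2 * N" .
      have "profile' (q p) = (1/2 + w/4) * w ^ 4"
        using w(4) iq by (metis divide_inverse inverse_eq_divide)
      then have k': "0 \<le> profile' (q p)" "profile' (q p) \<le> 3/4 * w ^ 4"
        using w(1,2) by (auto intro!: mult_right_mono)
      have "norm (\<xi> p - e) = 2 * \<epsilon> * profile' (q p) * norm (X p *\<^sub>R h1 + Y p *\<^sub>R h2)"
        using \<epsilon> k' by (simp add: \<xi>_def abs_mult)
      also have "\<dots> \<le> 2 * \<epsilon> * (3/4 * w ^ 4) * (1 / w\<^sup>2 * N)"
        using 1 k' \<epsilon> w by (intro mult_mono mult_left_mono) auto
      also have "\<dots> = 3/2 * \<epsilon> * N * w\<^sup>2"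
        using w(1) by (simp add: field_simps eval_nat_numeral)
      also have "\<dots> \<le> 3/2 * \<epsilon> * N * w"
        using w \<epsilon> N by (intro mult_left_mono) (auto simp: power2_eq_square)
      finally show ?thesis
        using norm_sgn_diff_le[OF e xi1] by simp
    qed
    have "3 * \<epsilon> * N * w \<le> 3 * \<epsilon> * N * 1"
      using w \<epsilon> N by (intro mult_left_mono) auto
    then have "norm (?n - e) < r" using near \<epsilon>2 by linarith
    note Lip = Lip[OF this]
    have "38 * (L * norm (?n - e)) \<le> 38 * (L * (3 * \<epsilon> * N * w))"
      using near L by (intro mult_left_mono) simp_all
    also have "\<dots> = 38 * (L * (3 * \<epsilon> * N)) * w" by simp
    also have "\<dots> < \<kappa> * w" using \<epsilon>3 w(1) by (rule mult_strict_right_mono)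
    finally have small: "38 * (L * norm (?n - e)) < \<kappa> * w" .
    have "?a * ?A ?n h1 h1 + 2 * ?b * ?A ?n h1 h2 + ?d * ?A ?n h2 h2 < 0"
      by (rule barrier_trace_negative[OF _ _ w(1,2,4,5) Lip small]) (use qp in \<open>auto simp: q_def\<close>)
    with contra show False by simp
  qed
  then show ?thesis using \<delta>(1) by (intro exI[of _ "\<delta> / 2"]) auto
qed

text \<open>Invariance of domain: \<psi> maps the part of the plane in a chart injectively and
  continuously into the parameter plane, so its image is open. Pulling this image back by \<psi>
  returns the same part of the plane.\<close>

lemma plane_openin_surface:
  fixes e :: "real^3"
  assumes surf: "smooth_surface \<Sigma>" and e: "e \<noteq> 0" and sub: "{x. e \<bullet> x = m} \<subseteq> \<Sigma>"
  shows "openin (top_of_set \<Sigma>) {x. e \<bullet> x = m}"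
proof (subst openin_subopen, intro ballI)
  let ?P = "{x. e \<bullet> x = m}"
  fix p assume p: "p \<in> ?P"
  obtain U and V :: "(real^2) set" and \<phi> \<psi> where *: "open U \<and> p \<in> U \<and> open V \<and>
      homeomorphism V (\<Sigma> \<inter> U) \<phi> \<psi> \<and> smooth_on \<phi> V \<and> (\<forall>u\<in>V. inj (frechet_derivative \<phi> (at u)))"
    using surf[unfolded smooth_surface_def, THEN bspec, OF subsetD[OF sub p]] by (elim exE) (rule that, assumption)
  have hom: "homeomorphism V (\<Sigma> \<inter> U) \<phi> \<psi>" and U: "open U" "p \<in> U" using * by auto
  have "openin (top_of_set UNIV) (\<psi> ` (?P \<inter> U))"
  proof (rule invariance_of_domain_affine_sets)
    show "openin (top_of_set ?P) (?P \<inter> U)" using U by (simp add: openin_open_Int)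
    show "affine ?P" "affine (UNIV :: (real^2) set)" by (auto simp: affine_hyperplane)
    show "aff_dim (UNIV :: (real^2) set) \<le> aff_dim ?P" using e by simp
    show "continuous_on (?P \<inter> U) \<psi>"
      using hom sub by (auto simp: homeomorphism_def intro: continuous_on_subset)
    show "inj_on \<psi> (?P \<inter> U)"
      using hom sub by (intro inj_on_inverseI[of _ \<phi>]) (auto simp: homeomorphism_def)
  qed auto
  then have "open (\<psi> ` (?P \<inter> U))" by simp
  then have "openin (top_of_set (\<Sigma> \<inter> U)) ((\<Sigma> \<inter> U) \<inter> \<psi> -` (\<psi> ` (?P \<inter> U)))"
    using hom by (intro continuous_openin_preimage_gen) (auto simp: homeomorphism_def)
  moreover have "(\<Sigma> \<inter> U) \<inter> \<psi> -` (\<psi> ` (?P \<inter> U)) = ?P \<inter> U"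
    using hom sub unfolding homeomorphism_def by (auto simp: subset_iff) (metis IntI)+
  moreover have "openin (top_of_set \<Sigma>) (\<Sigma> \<inter> U)" using U by (simp add: openin_open_Int)
  ultimately have "openin (top_of_set \<Sigma>) (?P \<inter> U)"
    using openin_trans by fastforce
  then show "\<exists>T. openin (top_of_set \<Sigma>) T \<and> p \<in> T \<and> T \<subseteq> ?P"
    using p U by (intro exI[of _ "?P \<inter> U"]) auto
qed

theorem theorem1p1:
  fixes \<Phi> :: "real^3 \<Rightarrow> real"
    and \<Sigma> :: "(real^3) set"
    and \<nu> :: "real^3 \<Rightarrow> real^3"
  assumes "admissible_integrand \<Phi>"
    and "\<forall>z. \<Phi> (- z) = \<Phi> z"
    and "smooth_surface \<Sigma>"
    and "\<Sigma> \<noteq> {}"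
    and "connected \<Sigma>"
    and "proper_in_space \<Sigma>"
    and "unit_normal \<Sigma> \<nu>"
    and "\<forall>x\<in>\<Sigma>. aniso_trace \<Phi> \<Sigma> \<nu> x = 0"
    and "\<exists>a b. a \<noteq> 0 \<and> \<Sigma> \<subseteq> {x. a \<bullet> x \<le> b}"
  shows "affine \<Sigma> \<and> aff_dim \<Sigma> = 2"
proof -
  obtain a b where a: "a \<noteq> 0" "\<Sigma> \<subseteq> {x. a \<bullet> x \<le> b}" using assms(9) by blast
  \<comment> \<open>The inner unit normal, so that the halfspace bounds e \<bullet> x from
    below.\<close>
  define e where "e = - sgn a"
  have e: "norm e = 1" "e \<noteq> 0" using a by (simp_all add: e_def norm_sgn sgn_zero_iff)
  define m where "m = Inf ((\<bullet>) e ` \<Sigma>)"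
  have "- b / norm a \<le> e \<bullet> x" if "x \<in> \<Sigma>" for x
    using a that by (auto simp: e_def sgn_div_norm divide_simps)
  then have "bdd_below ((\<bullet>) e ` \<Sigma>)" by (rule bdd_belowI2)
  then have lower: "m \<le> e \<bullet> x" if "x \<in> \<Sigma>" for x
    unfolding m_def using that by (auto intro: cInf_lower)
  let ?P = "{x. e \<bullet> x = m}"
  note closed = proper_imp_closed[OF assms(6)]
  have sub: "?P \<subseteq> \<Sigma>"
  proof (rule ccontr)
    assume "\<not> ?P \<subseteq> \<Sigma>"
    then obtain c where c: "e \<bullet> c = m" "c \<notin> \<Sigma>" by auto
    have "\<exists>\<delta>>0. \<forall>x\<in>\<Sigma>. m + \<delta> \<le> e \<bullet> x"
      by (rule gap_above_supporting_plane[OF assms(1-3,7,8) closed e(1) lower c])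
    then obtain \<delta> where \<delta>: "0 < \<delta>" "\<forall>x\<in>\<Sigma>. m + \<delta> \<le> e \<bullet> x" by blast
    then have "m + \<delta> \<le> m"
      unfolding m_def using assms(4) by (intro cInf_greatest) auto
    with \<delta> show False by simp
  qed
  have "m *\<^sub>R e \<in> ?P" using e by (simp add: norm_eq_1)
  then have "?P \<noteq> {}" by blast
  moreover have "openin (top_of_set \<Sigma>) ?P"
    by (rule plane_openin_surface[OF assms(3) e(2) sub])
  moreover have "closedin (top_of_set \<Sigma>) ?P"
    using sub by (intro closed_subset) (auto simp: closed_hyperplane)
  ultimately have "\<Sigma> = ?P"
    using assms(5) unfolding connected_clopen by blast
  then show ?thesis
    using e by (simp add: affine_hyperplane)
qed

end
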